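(* The polygon $P^2$ has the least area among all right-angled polygons (of finite area, with finitely many sides) in $H^2$.
   Context: Use the hyperboloid model $H^2=\{x\in\mathbb{R}^3: x_1^2+x_2^2-x_3^2=-1,\ x_3>0\}$. $P^2$ is the triangle $\{x\in H^2: x_1\ge0,\ x_2\ge0,\ x_1+x_2\le x_3\}$, which has one actual vertex $e_3$ with angle $\pi/2$ and two ideal vertices (represented by $e_1+e_3$ and $e_2+e_3$); its area is $\pi/2$. A polygon is right-angled if all its angles are $0$ or $\pi/2$. *)

theory Defs
  imports "HOL-Analysis.Analysis"
begin

definition mink :: "real^3 \<Rightarrow> real^3 \<Rightarrow> real" where
  "mink x y = x$1 * y$1 + x$2 * y$2 - x$3 * y$3"

definition H2 :: "(real^3) set" where
  "H2 = {x. x$1^2 + x$2^2 - x$3^2 = -1 \<and> x$3 > 0}"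

definition P2 :: "(real^3) set" where
  "P2 = {x \<in> H2. x$1 \<ge> 0 \<and> x$2 \<ge> 0 \<and> x$1 + x$2 \<le> x$3}"

text \<open>Chart (x1,x2) -> point of H2; the hyperbolic area element in this chart
  is dx1 dx2 / x3.\<close>
definition lift :: "real \<times> real \<Rightarrow> real^3" where
  "lift z = vector [fst z, snd z, sqrt (1 + (fst z)^2 + (snd z)^2)]"

definition hyp_area :: "(real^3) set \<Rightarrow> ennreal" where
  "hyp_area S = (\<integral>\<^sup>+ z. indicator {z. lift z \<in> S} z *
       ennreal (1 / sqrt (1 + (fst z)^2 + (snd z)^2)) \<partial>lborel)"

text \<open>A (convex) hyperbolic polygon with finitely many sides: a finite intersection of
  closed half-planes {x. mink x u \<le> 0} (u a unit spacelike outward normal), with nonempty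
  interior, such that every normal in N actually gives a side (its geodesic meets P in
  more than one point).\<close>
definition hyp_polygon :: "(real^3) set \<Rightarrow> (real^3) set \<Rightarrow> bool" where
  "hyp_polygon N P \<longleftrightarrow>
     finite N \<and> (\<forall>u\<in>N. mink u u = 1) \<and>
     P = {x \<in> H2. \<forall>u\<in>N. mink x u \<le> 0} \<and>
     (\<exists>x\<in>H2. \<forall>u\<in>N. mink x u < 0) \<and>
     (\<forall>u\<in>N. \<exists>x y. x \<noteq> y \<and> x \<in> P \<and> y \<in> P \<and> mink x u = 0 \<and> mink y u = 0)"

text \<open>Interior angle at a finite vertex where the sides with outward unit normals u, v meet.\<close>
definition interior_angle :: "real^3 \<Rightarrow> real^3 \<Rightarrow> real" where
  "interior_angle u v = arccos (- mink u v)"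

text \<open>Right-angled polygon of finite area: every finite vertex has angle pi/2
  (ideal vertices automatically have angle 0).\<close>
definition right_angled_polygon :: "(real^3) set \<Rightarrow> bool" where
  "right_angled_polygon P \<longleftrightarrow>
     (\<exists>N. hyp_polygon N P \<and>
        (\<forall>u\<in>N. \<forall>v\<in>N. \<forall>p\<in>P. u \<noteq> v \<and> mink p u = 0 \<and> mink p v = 0
             \<longrightarrow> interior_angle u v = pi / 2)) \<and>
     hyp_area P < \<infinity>"

end

theory Submission
  imports Defs "HOL-Library.Real_Mod"
begin

text \<open>
  By Lorentz invariance of the area we may place an interior point of the polygon at \<open>e\<^sub>3\<close>. In polar
  coordinates the area is the integral of \<open>cosh \<rho>(t) - 1\<close> over the circle of directions, \<open>\<rho>(t)\<close>
  being the distance to the boundary. Along a side with outward normal \<open>u\<close> a primitive of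
  \<open>cosh \<rho>\<close> is \<open>g = arcsin (u\<^sub>1 sin t - u\<^sub>2 cos t)\<close>, the signed angle between the ray and the normal of
  the side. At a right-angled vertex \<open>g\<close> jumps by \<open>\<pi>/2\<close> and at an ideal vertex by \<open>\<pi>\<close>, so
  \<open>exp (4 i g)\<close> is continuous on the whole circle and \<open>exp (4 i (g - \<integral> cosh \<rho>))\<close> is constant.
  Hence the area is an integer multiple of \<open>\<pi>/2\<close>; being positive, it is at least \<open>\<pi>/2\<close>, which is
  the area of \<open>P2\<close>. No cyclic ordering of the sides is needed.
\<close>

section \<open>Polar coordinates\<close>

text \<open>The substitution rule on a compact interval passes to increasing unions by monotone
  convergence. It serves for substitutions on an open interval (\<open>tan\<close>) and on the whole
  line (boosts).\<close>

lemma nn_integral_substitution_Union: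
  fixes f :: "real \<Rightarrow> ennreal" and g g' :: "real \<Rightarrow> real" and a b :: "nat \<Rightarrow> real"
  assumes [measurable]: "f \<in> borel_measurable borel" "g \<in> borel_measurable borel" "g' \<in> borel_measurable borel"
    and deriv: "\<And>n x. x \<in> {a n..b n} \<Longrightarrow> (g has_real_derivative g' x) (at x)"
    and cont: "\<And>n. continuous_on {a n..b n} g'"
    and nonneg: "\<And>n x. x \<in> {a n..b n} \<Longrightarrow> g' x \<ge> 0"
    and ab: "\<And>n. a n < b n" and a: "decseq a" and b: "incseq b"
  shows "(\<integral>\<^sup>+x. f x * indicator (\<Union>n. {g (a n)..g (b n)}) x \<partial>lborel) =
         (\<integral>\<^sup>+x. f (g x) * g' x * indicator (\<Union>n. {a n..b n}) x \<partial>lborel)"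
proof -
  have inc: "incseq (\<lambda>n. {a n..b n})"
    using a b by (fastforce simp: incseq_def decseq_def)
  have g_mono: "g x \<le> g y" if "x \<le> y" "x \<in> {a n..b n}" "y \<in> {a n..b n}" for x y n
    using that deriv[of _ n] nonneg[of _ n]
    by (intro DERIV_nonneg_imp_nondecreasing[of x y g]) (auto intro: order_trans)
  have inc': "incseq (\<lambda>n. {g (a n)..g (b n)})"
  proof (rule incseq_SucI)
    fix n
    have "a (Suc n) \<le> a n" "b n \<le> b (Suc n)"
      using a b by (auto simp: decseq_Suc_iff incseq_Suc_iff)
    moreover have "a n < b n" by (rule ab)
    ultimately have "g (a (Suc n)) \<le> g (a n)" "g (b n) \<le> g (b (Suc n))"
      by (auto intro!: g_mono[of _ _ "Suc n"])
    then show "{g (a n)..g (b n)} \<le> {g (a (Suc n))..g (b (Suc n))}" by auto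
  qed
  have limit: "(\<integral>\<^sup>+x. h x * indicator (\<Union>n. I n) x \<partial>lborel) = (SUP n. \<integral>\<^sup>+x. h x * indicator (I n) x \<partial>lborel)"
    if [measurable]: "h \<in> borel_measurable borel" "\<And>n. I n \<in> sets borel" and "incseq I"
    for h :: "real \<Rightarrow> ennreal" and I :: "nat \<Rightarrow> real set"
  proof -
    have "h x * indicator (\<Union>n. I n) x = (SUP n. h x * indicator (I n) x)" for x
    proof -
      have "indicator (\<Union>n. I n) x = (SUP n. indicator (I n) x :: ennreal)"
        by (rule antisym) (auto simp: indicator_def intro!: SUP_upper2 SUP_least)
      then show ?thesis by (simp add: SUP_mult_left_ennreal)
    qed
    moreover have "incseq (\<lambda>n x. h x * indicator (I n) x)"
      using \<open>incseq I\<close> by (auto simp: incseq_def le_fun_def indicator_def)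
    ultimately show ?thesis
      by (simp add: nn_integral_monotone_convergence_SUP)
  qed
  have "(\<integral>\<^sup>+x. f x * indicator {g (a n)..g (b n)} x \<partial>lborel) =
        (\<integral>\<^sup>+x. f (g x) * g' x * indicator {a n..b n} x \<partial>lborel)" for n
    by (rule nn_integral_substitution_aux[OF _ _ deriv cont nonneg ab]) auto
  then show ?thesis
    using inc inc' by (simp add: limit)
qed

text \<open>Two one-variable substitutions with Fubini in between: \<open>y = x * tan t\<close> for
  fixed \<open>x > 0\<close>, then \<open>x = r * cos t\<close> for fixed \<open>t\<close>.\<close>

lemma nn_integral_halfplane_polar:
  fixes F :: "real \<times> real \<Rightarrow> ennreal"
  assumes F[measurable]: "F \<in> borel_measurable borel"
  shows "(\<integral>\<^sup>+z. indicator {0<..} (fst z) * F z \<partial>lborel) =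
         (\<integral>\<^sup>+t. indicator {-pi/2<..<pi/2} t *
            (\<integral>\<^sup>+r. indicator {0<..} r * (ennreal r * F (r * cos t, r * sin t)) \<partial>lborel) \<partial>lborel)"
proof -
  interpret lborel_pair: pair_sigma_finite "lborel :: real measure" "lborel :: real measure" ..
  have F'[measurable]: "F \<in> borel_measurable (borel \<Otimes>\<^sub>M borel)"
    by (simp add: borel_prod)
  have m: "(\<lambda>x. F (f x, g x)) \<in> borel_measurable M"
    if "f \<in> borel_measurable M" "g \<in> borel_measurable M" for f g and M :: "'c measure"
    using that by measurable
  \<comment> \<open>At the endpoints \<open>tan\<close> takes the values n + 1 and -(n + 1); the
    summand 1 keeps the interval nondegenerate for n = 0.\<close>
  have Un1: "(\<Union>n. {- arctan (real n + 1)..arctan (real n + 1)}) = {-pi/2<..<pi/2}"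
  proof (safe)
    fix n t assume "t \<in> {- arctan (real n + 1)..arctan (real n + 1)}"
    then show "t \<in> {-pi/2<..<pi/2}"
      using arctan_bounded[of "real n + 1"] by auto
  next
    fix t :: real assume t: "t \<in> {-pi/2<..<pi/2}"
    obtain n where "\<bar>tan t\<bar> \<le> real n" using real_arch_simple by blast
    then have "- arctan (real n + 1) \<le> arctan (tan t)" "arctan (tan t) \<le> arctan (real n + 1)"
      by (auto simp flip: arctan_minus simp: arctan_le_iff)
    then show "t \<in> (\<Union>n. {- arctan (real n + 1)..arctan (real n + 1)})"
      using t by (auto simp: arctan_tan)
  qed
  have inner: "(\<integral>\<^sup>+y. F (x, y) \<partial>lborel) =
     (\<integral>\<^sup>+t. F (x, x * tan t) * (x / (cos t)\<^sup>2) * indicator {-pi/2<..<pi/2} t \<partial>lborel)" if "x > 0" for x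
  proof -
    have "(\<integral>\<^sup>+y. F (x, y) * indicator (\<Union>n. {x * tan (- arctan (real n + 1))..x * tan (arctan (real n + 1))}) y \<partial>lborel)
       = (\<integral>\<^sup>+t. F (x, x * tan t) * (x / (cos t)\<^sup>2) * indicator (\<Union>n. {- arctan (real n + 1)..arctan (real n + 1)}) t \<partial>lborel)"
    proof (rule nn_integral_substitution_Union)
      show "(\<lambda>t. x * tan t) \<in> borel_measurable borel" unfolding tan_def by measurable
      have c: "cos t > 0" if "t \<in> {- arctan (real n + 1)..arctan (real n + 1)}" for t n
        using that arctan_bounded[of "real n + 1"] by (intro cos_gt_zero_pi) auto
      show "((\<lambda>t. x * tan t) has_real_derivative x / (cos t)\<^sup>2) (at t)"
        if "t \<in> {- arctan (real n + 1)..arctan (real n + 1)}" for t n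
        using c[OF that] by (auto intro!: derivative_eq_intros simp: field_simps)
      show "continuous_on {- arctan (real n + 1)..arctan (real n + 1)} (\<lambda>t. x / (cos t)\<^sup>2)" for n
        using c[of _ n] by (intro continuous_intros) force
      show "decseq (\<lambda>n. - arctan (real n + 1))" "incseq (\<lambda>n. arctan (real n + 1))"
        by (auto simp: decseq_def incseq_def arctan_le_iff)
      show "- arctan (real n + 1) < arctan (real n + 1)" for n
        by (smt (verit) arctan_less_zero_iff arctan_minus of_nat_0_le_iff zero_less_arctan_iff)
    qed (use that in \<open>auto intro!: m\<close>)
    moreover have "(\<Union>n. {x * tan (- arctan (real n + 1))..x * tan (arctan (real n + 1))}) = UNIV"
    proof -
      have "\<exists>n. x * (- real n - 1) \<le> y \<and> y \<le> x * (real n + 1)" for y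
      proof -
        obtain n where "\<bar>y\<bar> / x \<le> real n" using real_arch_simple by blast
        then have "\<bar>y\<bar> \<le> x * (real n + 1)" using that by (simp add: field_simps)
        then show ?thesis by (intro exI[of _ n]) (auto simp: algebra_simps)
      qed
      then show ?thesis by (auto simp: tan_arctan)
    qed
    ultimately show ?thesis by (simp add: Un1)
  qed
  have "(\<integral>\<^sup>+z. indicator {0<..} (fst z) * F z \<partial>lborel) =
        (\<integral>\<^sup>+x. \<integral>\<^sup>+y. indicator {0<..} x * F (x, y) \<partial>lborel \<partial>lborel)"
    by (subst lborel_prod[symmetric], subst lborel.nn_integral_fst[symmetric]) auto
  also have "\<dots> = (\<integral>\<^sup>+x. indicator {0<..} x * (\<integral>\<^sup>+y. F (x, y) \<partial>lborel) \<partial>lborel)"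
    by (simp add: nn_integral_cmult)
  also have "\<dots> = (\<integral>\<^sup>+x. \<integral>\<^sup>+t. indicator {0<..} x *
      (F (x, x * tan t) * (x / (cos t)\<^sup>2) * indicator {-pi/2<..<pi/2} t) \<partial>lborel \<partial>lborel)"
    unfolding tan_def
    by (subst nn_integral_cmult) (auto intro!: nn_integral_cong m simp: inner indicator_def tan_def)
  also have "\<dots> = (\<integral>\<^sup>+t. \<integral>\<^sup>+x. indicator {0<..} x *
      (F (x, x * tan t) * (x / (cos t)\<^sup>2) * indicator {-pi/2<..<pi/2} t) \<partial>lborel \<partial>lborel)"
    unfolding tan_def by (rule lborel_pair.Fubini'[symmetric]) measurable
  also have "\<dots> = (\<integral>\<^sup>+t. indicator {-pi/2<..<pi/2} t *
            (\<integral>\<^sup>+r. indicator {0<..} r * (ennreal r * F (r * cos t, r * sin t)) \<partial>lborel) \<partial>lborel)"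
  proof (rule nn_integral_cong)
    fix t :: real
    show "(\<integral>\<^sup>+x. indicator {0<..} x * (F (x, x * tan t) * (x / (cos t)\<^sup>2) * indicator {-pi/2<..<pi/2} t) \<partial>lborel)
      = indicator {-pi/2<..<pi/2} t * (\<integral>\<^sup>+r. indicator {0<..} r * (ennreal r * F (r * cos t, r * sin t)) \<partial>lborel)"
    proof (cases "t \<in> {-pi/2<..<pi/2}")
      case True
      then have c: "cos t > 0" by (intro cos_gt_zero_pi) auto
      have "(\<integral>\<^sup>+x. indicator {0<..} x * (F (x, x * tan t) * (x / (cos t)\<^sup>2)) \<partial>lborel) =
         \<bar>cos t\<bar> * (\<integral>\<^sup>+r. indicator {0<..} (0 + cos t * r) *
            (F (0 + cos t * r, (0 + cos t * r) * tan t) * ((0 + cos t * r) / (cos t)\<^sup>2)) \<partial>lborel)"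
        by (rule nn_integral_real_affine) (use c in \<open>auto intro!: m\<close>)
      also have "\<dots> = (\<integral>\<^sup>+r. \<bar>cos t\<bar> * (indicator {0<..} (0 + cos t * r) *
            (F (0 + cos t * r, (0 + cos t * r) * tan t) * ((0 + cos t * r) / (cos t)\<^sup>2))) \<partial>lborel)"
        by (rule nn_integral_cmult[symmetric]) (auto intro!: m)
      also have "\<dots> = (\<integral>\<^sup>+r. indicator {0<..} r * (ennreal r * F (r * cos t, r * sin t)) \<partial>lborel)"
      proof (rule nn_integral_cong)
        fix r
        \<comment> \<open>The factor \<open>x / (cos t)\<^sup>2\<close> of the first substitution
          and the factor \<open>cos t\<close> of the second combine to the polar Jacobian
          \<open>r\<close>.\<close>
        have "ennreal (cos t) * ennreal (r * cos t / (cos t)\<^sup>2) = ennreal r" if "r > 0"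
          using c that by (subst ennreal_mult[symmetric]) (auto simp: power2_eq_square)
        then have "ennreal (cos t) * (X * ennreal (r * cos t / (cos t)\<^sup>2)) = ennreal r * X" if "r > 0" for X
          using that by (metis mult.assoc mult.commute)
        then show "\<bar>cos t\<bar> * (indicator {0<..} (0 + cos t * r) *
            (F (0 + cos t * r, (0 + cos t * r) * tan t) * ((0 + cos t * r) / (cos t)\<^sup>2))) =
            indicator {0<..} r * (ennreal r * F (r * cos t, r * sin t))"
          using c by (auto simp: indicator_def tan_def zero_less_mult_iff mult.commute[of "cos t" r])
      qed
      finally show ?thesis using True by simp
    qed simp
  qed
  finally show ?thesis .
qed

text \<open>The point reflection in the origin carries the left half plane to the right one and
  shifts the angle by \<open>pi\<close>; the line between them is a null set. Starting the period at
  \<open>-pi/2\<close> makes each half plane a single range of angles.\<close>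

lemma nn_integral_polar:
  fixes F :: "real \<times> real \<Rightarrow> ennreal"
  assumes F[measurable]: "F \<in> borel_measurable borel"
  shows "(\<integral>\<^sup>+z. F z \<partial>lborel) =
         (\<integral>\<^sup>+t. indicator {-pi/2..3*pi/2} t *
            (\<integral>\<^sup>+r. indicator {0<..} r * (ennreal r * F (r * cos t, r * sin t)) \<partial>lborel) \<partial>lborel)"
proof -
  let ?G = "\<lambda>t. \<integral>\<^sup>+r. indicator {0<..} r * (ennreal r * F (r * cos t, r * sin t)) \<partial>lborel"
  have F'[measurable]: "F \<in> borel_measurable (borel \<Otimes>\<^sub>M borel)"
    by (simp add: borel_prod)
  have m: "(\<lambda>x. F (f x, g x)) \<in> borel_measurable M"
    if "f \<in> borel_measurable M" "g \<in> borel_measurable M" for f g and M :: "'c measure"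
    using that by measurable
  have [measurable]: "?G \<in> borel_measurable borel" by measurable
  have [measurable]: "(fst :: real \<times> real \<Rightarrow> real) \<in> borel_measurable borel"
    by (intro borel_measurable_continuous_onI continuous_intros)
  have reflect: "(\<integral>\<^sup>+z. H z \<partial>lborel) = (\<integral>\<^sup>+z. H (- z) \<partial>lborel)"
    if [measurable]: "H \<in> borel_measurable borel" for H :: "real \<times> real \<Rightarrow> ennreal"
  proof -
    have [measurable]: "H \<in> borel_measurable (borel \<Otimes>\<^sub>M borel)" by (simp add: borel_prod)
    have "(\<integral>\<^sup>+z. H z \<partial>lborel) = (\<integral>\<^sup>+x. \<integral>\<^sup>+y. H (x, y) \<partial>lborel \<partial>lborel)"
      by (subst lborel_prod[symmetric], subst lborel.nn_integral_fst[symmetric]) auto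
    also have "\<dots> = (\<integral>\<^sup>+x. \<integral>\<^sup>+y. H (x, - y) \<partial>lborel \<partial>lborel)"
      by (subst nn_integral_real_affine[where c = "-1" and t = 0]) auto
    also have "\<dots> = (\<integral>\<^sup>+x. \<integral>\<^sup>+y. H (- x, - y) \<partial>lborel \<partial>lborel)"
      by (subst nn_integral_real_affine[where c = "-1" and t = 0]) auto
    also have "\<dots> = (\<integral>\<^sup>+x. \<integral>\<^sup>+y. H (- (x, y)) \<partial>lborel \<partial>lborel)" by simp
    also have "\<dots> = (\<integral>\<^sup>+z. H (- z) \<partial>lborel)"
      by (subst lborel.nn_integral_fst) (auto simp: lborel_prod)
    finally show ?thesis .
  qed
  have left: "(\<integral>\<^sup>+z. indicator {..<0} (fst z) * F z \<partial>lborel) =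
      (\<integral>\<^sup>+t. indicator {pi/2<..<3*pi/2} t * ?G t \<partial>lborel)"
  proof -
    have "(\<integral>\<^sup>+z. indicator {..<0} (fst z) * F z \<partial>lborel) =
          (\<integral>\<^sup>+z. indicator {0<..} (fst z) * F (- z) \<partial>lborel)"
      by (subst reflect, measurable) (auto intro!: nn_integral_cong simp: indicator_def)
    also have "\<dots> = (\<integral>\<^sup>+t. indicator {-pi/2<..<pi/2} t * ?G (pi + 1 * t) \<partial>lborel)"
      by (subst nn_integral_halfplane_polar) auto
    also have "\<dots> = (\<integral>\<^sup>+t. indicator {pi/2<..<3*pi/2} (pi + 1 * t) * ?G (pi + 1 * t) \<partial>lborel)"
      by (intro nn_integral_cong) (auto simp: indicator_def)
    also have "\<dots> = (\<integral>\<^sup>+t. indicator {pi/2<..<3*pi/2} t * ?G t \<partial>lborel)"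
      by (subst (3) nn_integral_real_affine[where c = 1 and t = pi]) auto
    finally show ?thesis .
  qed
  have null: "(\<integral>\<^sup>+z. indicator {0} (fst z) * F z \<partial>lborel) = 0"
  proof -
    have "(\<integral>\<^sup>+z. indicator {0} (fst z) * F z \<partial>lborel) =
        (\<integral>\<^sup>+x. \<integral>\<^sup>+y. indicator {0} x * F (x, y) \<partial>lborel \<partial>lborel)"
      by (subst lborel_prod[symmetric], subst lborel.nn_integral_fst[symmetric]) auto
    also have "\<dots> = (\<integral>\<^sup>+x. indicator {0} x * (\<integral>\<^sup>+y. F (x, y) \<partial>lborel) \<partial>lborel)"
      by (simp add: nn_integral_cmult)
    also have "\<dots> = (\<integral>\<^sup>+(x::real). 0 \<partial>lborel)"
      using AE_lborel_singleton[of "0::real"] by (intro nn_integral_cong_AE, eventually_elim) (auto simp: indicator_def)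
    finally show ?thesis by simp
  qed
  have "(\<integral>\<^sup>+z. F z \<partial>lborel) = (\<integral>\<^sup>+z. (indicator {0<..} (fst z) * F z + indicator {..<0} (fst z) * F z)
      + indicator {0} (fst z) * F z \<partial>lborel)"
    by (intro nn_integral_cong) (auto simp: indicator_def)
  also have "\<dots> = (\<integral>\<^sup>+t. indicator {-pi/2<..<pi/2} t * ?G t \<partial>lborel) +
      (\<integral>\<^sup>+t. indicator {pi/2<..<3*pi/2} t * ?G t \<partial>lborel)"
    by (simp add: nn_integral_add left null nn_integral_halfplane_polar)
  also have "\<dots> = (\<integral>\<^sup>+t. indicator {-pi/2<..<pi/2} t * ?G t + indicator {pi/2<..<3*pi/2} t * ?G t \<partial>lborel)"
    by (simp add: nn_integral_add)
  also have "\<dots> = (\<integral>\<^sup>+t. indicator {-pi/2..3*pi/2} t * ?G t \<partial>lborel)"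
    using AE_lborel_singleton[of "-pi/2"] AE_lborel_singleton[of "pi/2"] AE_lborel_singleton[of "3*pi/2"]
    by (intro nn_integral_cong_AE, eventually_elim) (auto simp: indicator_def)
  finally show ?thesis .
qed

section \<open>Lorentz invariance of the area\<close>

definition region :: "(real^3) set \<Rightarrow> (real^3) set" where
  "region N = {x \<in> H2. \<forall>u\<in>N. mink x u \<le> 0}"

definition height :: "real \<times> real \<Rightarrow> real" where
  "height z = sqrt (1 + (fst z)\<^sup>2 + (snd z)\<^sup>2)"

lemma height_pos [simp]: "0 < height z"
  by (simp add: height_def add_pos_nonneg)

lemma height_squared: "(height z)\<^sup>2 = 1 + (fst z)\<^sup>2 + (snd z)\<^sup>2"
  by (simp add: height_def)

lemma continuous_on_height [continuous_intros]: "continuous_on A height"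
  unfolding height_def by (intro continuous_intros)

lemma lift_nth [simp]: "lift z $ 1 = fst z" "lift z $ 2 = snd z" "lift z $ 3 = height z"
  by (simp_all add: lift_def height_def)

lemma lift_in_H2 [simp]: "lift z \<in> H2"
  using height_squared[of z] by (simp add: H2_def)

lemma lift_in_region: "lift z \<in> region N \<longleftrightarrow> (\<forall>u\<in>N. fst z * u$1 + snd z * u$2 \<le> height z * u$3)"
  by (simp add: region_def mink_def)

lemma H2_eq_lift: "x \<in> H2 \<Longrightarrow> x = lift (x$1, x$2)"
  by (auto simp: H2_def vec_eq_iff forall_3 height_def intro!: real_sqrt_unique[symmetric])

lemma hyp_area_eq: "hyp_area S = (\<integral>\<^sup>+z. indicator {z. lift z \<in> S} z * ennreal (1 / height z) \<partial>lborel)"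
  by (simp add: hyp_area_def height_def)

lemma measurable_height [measurable]: "height \<in> borel_measurable borel"
  by (intro borel_measurable_continuous_onI continuous_intros)

lemma measurable_region [measurable]: "{z. lift z \<in> region N} \<in> sets borel"
proof -
  have "closed (\<Inter>u\<in>N. {z. fst z * u$1 + snd z * u$2 \<le> height z * u$3})"
    by (intro closed_INT ballI closed_Collect_le continuous_intros)
  moreover have "{z. lift z \<in> region N} = (\<Inter>u\<in>N. {z. fst z * u$1 + snd z * u$2 \<le> height z * u$3})"
    by (auto simp: lift_in_region)
  ultimately show ?thesis by simp
qed

text \<open>Moving a region means moving its normals, so the area clause is phrased through the
  normals and composes directly.\<close>

definition isometry_H2 :: "(real^3 \<Rightarrow> real^3) \<Rightarrow> bool" where
  "isometry_H2 A \<longleftrightarrow> (\<forall>x y. mink (A x) (A y) = mink x y) \<and> A ` H2 = H2 \<and>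
     (\<forall>N. hyp_area (region (A ` N)) = hyp_area (region N))"

lemma isometry_H2_comp: "isometry_H2 A \<Longrightarrow> isometry_H2 B \<Longrightarrow> isometry_H2 (A \<circ> B)"
  unfolding isometry_H2_def image_comp[symmetric] comp_apply by metis

text \<open>Under \<open>c\<^sup>2 - s\<^sup>2 = 1\<close> and \<open>c > 0\<close> this is the
  hyperbolic translation along the geodesic \<open>x$2 = 0\<close>, with \<open>c\<close> and
  \<open>s\<close> the hyperbolic cosine and sine of the signed distance.\<close>

definition boost :: "real \<Rightarrow> real \<Rightarrow> real^3 \<Rightarrow> real^3" where
  "boost c s x = vector [c * x$1 + s * x$3, x$2, s * x$1 + c * x$3]"

definition swap12 :: "real^3 \<Rightarrow> real^3" where
  "swap12 x = vector [x$2, x$1, x$3]"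

lemma boost_nth [simp]: "boost c s x $ 1 = c * x$1 + s * x$3" "boost c s x $ 2 = x$2"
    "boost c s x $ 3 = s * x$1 + c * x$3"
  by (simp_all add: boost_def)

lemma swap12_nth [simp]: "swap12 x $ 1 = x$2" "swap12 x $ 2 = x$1" "swap12 x $ 3 = x$3"
  by (simp_all add: swap12_def)

lemma isometry_H2_swap12: "isometry_H2 swap12"
proof -
  have inv: "swap12 (swap12 x) = x" for x
    by (simp add: vec_eq_iff forall_3)
  have mink: "mink (swap12 x) (swap12 y) = mink x y" for x y
    by (simp add: mink_def)
  have H2: "swap12 x \<in> H2" if "x \<in> H2" for x
    using that by (simp add: H2_def add.commute)
  interpret lborel_pair: pair_sigma_finite "lborel :: real measure" "lborel :: real measure" ..
  have area: "hyp_area (region (swap12 ` N)) = hyp_area (region N)" for N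
  proof -
    have "hyp_area (region (swap12 ` N)) =
       (\<integral>\<^sup>+z. indicator {z. lift z \<in> region (swap12 ` N)} z * ennreal (1 / height z) \<partial>(lborel \<Otimes>\<^sub>M lborel))"
      by (simp add: hyp_area_eq lborel_prod)
    also have "\<dots> = (\<integral>\<^sup>+z. indicator {z. lift z \<in> region (swap12 ` N)} z * ennreal (1 / height z)
        \<partial>distr (lborel \<Otimes>\<^sub>M lborel) (lborel \<Otimes>\<^sub>M lborel) (\<lambda>(x, y). (y, x)))"
      by (subst lborel_pair.distr_pair_swap) simp
    also have "\<dots> = (\<integral>\<^sup>+z. indicator {z. lift z \<in> region (swap12 ` N)} (snd z, fst z) * ennreal (1 / height (snd z, fst z))
        \<partial>(lborel \<Otimes>\<^sub>M lborel))"
      by (subst nn_integral_distr) (auto simp: lborel_prod case_prod_beta intro!: borel_measurable_continuous_onI continuous_intros)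
    also have "\<dots> = hyp_area (region N)"
      unfolding hyp_area_eq lborel_prod
      by (intro nn_integral_cong)
         (auto simp: indicator_def lift_in_region height_def add_ac)
    finally show ?thesis .
  qed
  show ?thesis
    unfolding isometry_H2_def using mink H2 inv area by (auto simp: image_iff) metis
qed

text \<open>In the chart a boost changes only the first coordinate, so by Fubini its effect on area
  is a one-variable substitution on each line of constant second coordinate. The derivative is the
  quotient of the new height by the old one, which cancels the change of the density
  \<open>1 / height z\<close>.\<close>

lemma isometry_H2_boost:
  assumes cs: "c\<^sup>2 - s\<^sup>2 = 1" and c: "c > 0"
  shows "isometry_H2 (boost c s)"
proof -
  have sc: "\<bar>s\<bar> < c"
  proof (rule power2_less_imp_less)
    show "\<bar>s\<bar>\<^sup>2 < c\<^sup>2" using cs unfolding power2_abs by linarith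
  qed (use c in simp)
  have inv: "boost c (-s) (boost c s x) = x" "boost c s (boost c (-s) x) = x" for x
  proof -
    have "c * (c * x$1 + s * x$3) - s * (s * x$1 + c * x$3) = (c\<^sup>2 - s\<^sup>2) * x$1"
      "c * (s * x$1 + c * x$3) - s * (c * x$1 + s * x$3) = (c\<^sup>2 - s\<^sup>2) * x$3"
      "c * (c * x$1 - s * x$3) + s * (c * x$3 - s * x$1) = (c\<^sup>2 - s\<^sup>2) * x$1"
      "s * (c * x$1 - s * x$3) + c * (c * x$3 - s * x$1) = (c\<^sup>2 - s\<^sup>2) * x$3"
      by (simp_all add: algebra_simps power2_eq_square)
    then show "boost c (-s) (boost c s x) = x" "boost c s (boost c (-s) x) = x"
      using cs by (simp_all add: vec_eq_iff forall_3)
  qed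
  have minkd: "mink (boost c d x) (boost c d y) = (c\<^sup>2 - d\<^sup>2) * (x$1*y$1 - x$3*y$3) + x$2*y$2" for x y d
    by (simp add: mink_def algebra_simps power2_eq_square)
  \<comment> \<open>The condition on \<open>d\<close> covers the boost and its inverse at once. The
    inequalities \<open>\<bar>d\<bar> < c\<close> and \<open>\<bar>x$1\<bar> < x$3\<close> keep the
    image on the upper sheet.\<close>
  have H2: "boost c d x \<in> H2" if x: "x \<in> H2" and d: "d\<^sup>2 = s\<^sup>2" for x d
  proof -
    have "mink x x = -1" "x$3 > 0" "x$1^2 + x$2^2 - x$3^2 = -1"
      using x by (auto simp: H2_def mink_def power2_eq_square)
    then have 1: "mink (boost c d x) (boost c d x) = -1" 
      using minkd[of d x x] cs d by (simp add: mink_def)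
    have "\<bar>d\<bar> < c" using sc d by (metis power2_eq_iff abs_minus_cancel)
    have "\<bar>x$1\<bar> < x$3"
    proof (rule power2_less_imp_less)
      show "\<bar>x$1\<bar>\<^sup>2 < (x$3)\<^sup>2"
        using \<open>x$1^2 + x$2^2 - x$3^2 = -1\<close> zero_le_power2[of "x$2"] unfolding power2_abs by linarith
    qed (use \<open>x$3 > 0\<close> in simp)
    then have "\<bar>d * x$1\<bar> < c * x$3"
      using \<open>\<bar>d\<bar> < c\<close> unfolding abs_mult by (intro mult_strict_mono') auto
    then show ?thesis
      using 1 by (simp add: H2_def mink_def power2_eq_square)
  qed
  interpret lborel_pair: pair_sigma_finite "lborel :: real measure" "lborel :: real measure" ..
  have lift_boost: "boost c s (lift (x, y)) = lift (c * x + s * height (x, y), y)" for x y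
    using H2_eq_lift[OF H2[OF lift_in_H2 refl]] by simp
  define g where "g y x = c * x + s * height (x, y)" for y x
  have height_g: "height (g y x, y) = s * x + c * height (x, y)" for x y
    using lift_boost[of x y] unfolding g_def by (metis boost_nth(3) lift_nth(1,3) fst_conv)
  define g' where "g' y x = c + s * x / height (x, y)" for y x
  have g'_eq: "g' y x = height (g y x, y) / height (x, y)" for x y
    by (simp add: g'_def height_g field_simps less_imp_neq[OF height_pos, symmetric])
  have g'_pos: "g' y x > 0" for x y
    by (simp add: g'_eq)
  have deriv: "(g y has_real_derivative g' y x) (at x)" for x y
  proof -
    have "1 + (x\<^sup>2 + y\<^sup>2) > 0" by (simp add: add_pos_nonneg)
    then show ?thesis
      unfolding g_def g'_def height_def
      by (auto intro!: derivative_eq_intros simp: field_simps)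
  qed
  have mono: "x \<le> x' \<Longrightarrow> g y x \<le> g y x'" for x x' y
    using deriv g'_pos by (intro DERIV_nonneg_imp_nondecreasing[of x x' "g y"]) (blast intro: less_imp_le)+
  have surj: "\<exists>x0. g y x0 = x" for x y
  proof -
    have "boost c (-s) (lift (x, y)) \<in> H2" by (rule H2) auto
    then have "boost c (-s) (lift (x, y)) = lift (c * x - s * height (x, y), y)"
      using H2_eq_lift[of "boost c (-s) (lift (x, y))"] by simp
    then have "lift (x, y) = lift (g y (c * x - s * height (x, y)), y)"
      using inv(2)[of "lift (x, y)"] lift_boost[of "c * x - s * height (x, y)" y] by (simp add: g_def)
    then show ?thesis by (metis lift_nth(1) fst_conv)
  qed
  have subst: "(\<integral>\<^sup>+x. f x \<partial>lborel) = (\<integral>\<^sup>+x. f (g y x) * g' y x \<partial>lborel)"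
    if [measurable]: "f \<in> borel_measurable borel" for f :: "real \<Rightarrow> ennreal" and y
  proof -
    have cont: "continuous_on UNIV (g' y)" "continuous_on UNIV (g y)"
    proof -
      have "1 + x\<^sup>2 + y\<^sup>2 \<noteq> 0" for x
        using zero_le_power2[of x] zero_le_power2[of y] by linarith
      then show "continuous_on UNIV (g' y)" "continuous_on UNIV (g y)"
        unfolding g'_def g_def height_def by (auto intro!: continuous_intros)
    qed
    have "(\<integral>\<^sup>+x. f x * indicator (\<Union>n. {g y (- real n - 1)..g y (real n + 1)}) x \<partial>lborel) =
      (\<integral>\<^sup>+x. f (g y x) * g' y x * indicator (\<Union>n. {- real n - 1..real n + 1}) x \<partial>lborel)"
    proof (rule nn_integral_substitution_Union)
      show "g y \<in> borel_measurable borel" "g' y \<in> borel_measurable borel"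
        using cont by (auto intro: borel_measurable_continuous_onI)
      show "continuous_on {- real n - 1..real n + 1} (g' y)" for n
        using cont(1) continuous_on_subset by blast
      show "decseq (\<lambda>n. - real n - 1)" "incseq (\<lambda>n. real n + 1)"
        by (auto simp: decseq_def incseq_def)
      show "- real n - 1 < real n + 1" for n
        by linarith
    qed (use deriv g'_pos less_imp_le that in blast)+
    moreover have "(\<Union>n. {- real n - 1..real n + 1}) = (UNIV :: real set)"
    proof -
      have "\<exists>n. - real n - 1 \<le> x \<and> x \<le> real n + 1" for x
        using real_arch_simple[of "\<bar>x\<bar>"] by (metis abs_le_iff add_increasing2 diff_le_eq minus_le_iff zero_le_one)
      then show ?thesis by auto
    qed
    moreover have "(\<Union>n. {g y (- real n - 1)..g y (real n + 1)}) = UNIV"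
    proof -
      have "\<exists>n. g y (- real n - 1) \<le> x \<and> x \<le> g y (real n + 1)" for x
      proof -
        obtain x0 where "g y x0 = x" using surj by blast
        obtain n where "\<bar>x0\<bar> \<le> real n" using real_arch_simple by blast
        then have "g y (- real n - 1) \<le> g y x0" "g y x0 \<le> g y (real n + 1)" by (auto intro!: mono)
        then show ?thesis using \<open>g y x0 = x\<close> by auto
      qed
      then show ?thesis by auto
    qed
    ultimately show ?thesis by simp
  qed
  have area: "hyp_area (region (boost c s ` N)) = hyp_area (region N)" for N
  proof -
    let ?F = "\<lambda>N z. indicator {z. lift z \<in> region N} z * ennreal (1 / height z)"
    have m: "?F N \<in> borel_measurable (lborel \<Otimes>\<^sub>M lborel)" for N
      by (simp add: lborel_prod)
    have m': "?F N \<in> borel_measurable (borel \<Otimes>\<^sub>M borel)" for N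
      by (simp add: borel_prod)
    have fubini: "hyp_area (region N) = (\<integral>\<^sup>+y. \<integral>\<^sup>+x. ?F N (x, y) \<partial>lborel \<partial>lborel)" for N
      using lborel_pair.nn_integral_snd[OF m[of N]] by (simp add: hyp_area_eq lborel_prod)
    have "hyp_area (region (boost c s ` N)) =
       (\<integral>\<^sup>+y. \<integral>\<^sup>+x. ?F (boost c s ` N) (g y x, y) * g' y x \<partial>lborel \<partial>lborel)"
      unfolding fubini
      by (intro nn_integral_cong subst measurable_compose[OF _ m']) measurable
    also have "\<dots> = (\<integral>\<^sup>+y. \<integral>\<^sup>+x. ?F N (x, y) \<partial>lborel \<partial>lborel)"
    proof (intro nn_integral_cong)
      fix x y
      have "lift (g y x, y) \<in> region (boost c s ` N) \<longleftrightarrow> lift (x, y) \<in> region N"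
        using minkd[of s] cs unfolding g_def lift_boost[symmetric]
        by (simp add: region_def H2) (simp add: mink_def algebra_simps)
      moreover have "ennreal (1 / height (g y x, y)) * ennreal (g' y x) = ennreal (1 / height (x, y))"
        by (subst ennreal_mult[symmetric])
           (auto simp: g'_eq less_imp_le less_imp_neq[OF height_pos, symmetric])
      ultimately show "?F (boost c s ` N) (g y x, y) * g' y x = ?F N (x, y)"
        by (simp add: mult.assoc indicator_def)
    qed
    finally show ?thesis by (simp add: fubini)
  qed
  have "boost c s ` H2 = H2"
  proof
    show "boost c s ` H2 \<subseteq> H2" using H2 by auto
    show "H2 \<subseteq> boost c s ` H2"
    proof
      fix x assume "x \<in> H2"
      then have "boost c (-s) x \<in> H2" by (rule H2) auto
      then show "x \<in> boost c s ` H2" using inv(2)[of x] by (metis image_eqI)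
    qed
  qed
  then show ?thesis
    using area minkd[of s] cs by (simp add: isometry_H2_def) (simp add: mink_def algebra_simps)
qed

text \<open>The target \<open>lift (0, 0)\<close> is \<open>e\<^sub>3\<close>. One boost makes the
  first coordinate vanish, \<open>swap12\<close> brings the second into its place, and another boost
  makes that vanish too.\<close>

lemma isometry_H2_transitive:
  assumes x: "x \<in> H2"
  obtains A where "isometry_H2 A" "A x = lift (0, 0)"
proof -
  \<comment> \<open>On the hyperboloid \<open>q\<close> is also the square root of
    \<open>(x$3)\<^sup>2 - (x$1)\<^sup>2\<close>, so \<open>x$3 / q\<close> and
    \<open>- x$1 / q\<close> are admissible boost parameters.\<close>
  define q where "q = sqrt (1 + (x$2)\<^sup>2)"
  have q: "q > 0" "q\<^sup>2 = 1 + (x$2)\<^sup>2" by (auto simp: q_def add_pos_nonneg)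
  have x': "x$3 > 0" "(x$3)\<^sup>2 - (x$1)\<^sup>2 = q\<^sup>2" using x q by (auto simp: H2_def)
  have 1: "isometry_H2 (boost (x$3 / q) (- x$1 / q))"
    using x' q by (intro isometry_H2_boost) (auto simp: power_divide diff_divide_distrib[symmetric])
  have 2: "isometry_H2 (boost q (- x$2))"
    using q by (intro isometry_H2_boost) auto
  have "(x$3 * x$3 - x$1 * x$1) / q = q"
    using x' q(1) by (simp only: power2_eq_square) simp
  then have e: "boost (x$3 / q) (- x$1 / q) x = vector [0, x$2, q]"
    by (simp add: vec_eq_iff forall_3 diff_divide_distrib)
  have "(boost q (- x$2) \<circ> (swap12 \<circ> boost (x$3 / q) (- x$1 / q))) x = lift (0, 0)"
    unfolding comp_apply e using q by (simp add: vec_eq_iff forall_3 height_def power2_eq_square)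
  then show ?thesis
    using that 1 2 isometry_H2_swap12 isometry_H2_comp by blast
qed

section \<open>Area in polar coordinates\<close>

lemma radial_integral_Icc:
  assumes "R \<ge> 0"
  shows "(\<integral>\<^sup>+r. ennreal (r / sqrt (1 + r\<^sup>2)) * indicator {0..R} r \<partial>lborel) = ennreal (sqrt (1 + R\<^sup>2) - 1)"
proof -
  have "((\<lambda>r. r / sqrt (1 + r\<^sup>2)) has_integral (sqrt (1 + R\<^sup>2) - sqrt (1 + 0\<^sup>2))) {0..R}"
  proof (rule fundamental_theorem_of_calculus)
    fix r :: real
    have "1 + r\<^sup>2 > 0" by (simp add: add_pos_nonneg)
    then show "((\<lambda>r. sqrt (1 + r\<^sup>2)) has_vector_derivative r / sqrt (1 + r\<^sup>2)) (at r within {0..R})"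
      unfolding has_real_derivative_iff_has_vector_derivative[symmetric]
      by (auto intro!: derivative_eq_intros simp: field_simps)
  qed (use assms in simp)
  from nn_integral_has_integral_lebesgue'[OF _ this] show ?thesis by simp
qed

text \<open>With \<open>r = sinh \<rho>\<close> the constraint reads
  \<open>T * tanh \<rho> \<le> 1\<close>: it stops the ray at \<open>tanh \<rho> = 1 / T\<close> if
  \<open>T > 1\<close> and never stops it otherwise. The integrand has the primitive
  \<open>sqrt (1 + r\<^sup>2)\<close>, which is \<open>cosh \<rho>\<close>.\<close>

lemma radial_integral:
  fixes T :: real
  shows "(\<integral>\<^sup>+r. indicator {0<..} r * (ennreal r * (indicator {r. r * T \<le> sqrt (1 + r\<^sup>2)} r * ennreal (1 / sqrt (1 + r\<^sup>2)))) \<partial>lborel)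
     = (if T > 1 then ennreal (T / sqrt (T\<^sup>2 - 1) - 1) else \<infinity>)"
    (is "?I = _")
proof -
  have I: "?I = (\<integral>\<^sup>+r. ennreal (r / sqrt (1 + r\<^sup>2)) * indicator {r. 0 < r \<and> r * T \<le> sqrt (1 + r\<^sup>2)} r \<partial>lborel)"
    by (intro nn_integral_cong) (auto simp: indicator_def simp flip: ennreal_mult)
  show ?thesis
  proof (cases "T > 1")
    case True
    define R where "R = 1 / sqrt (T\<^sup>2 - 1)"
    have T2: "T\<^sup>2 > 1" using True by (simp add: one_less_power)
    have R: "R > 0" "R\<^sup>2 = 1 / (T\<^sup>2 - 1)" using T2 by (simp_all add: R_def power_divide)
    have "r * T \<le> sqrt (1 + r\<^sup>2) \<longleftrightarrow> r \<le> R" if "r > 0" for r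
    proof -
      have "r * T \<le> sqrt (1 + r\<^sup>2) \<longleftrightarrow> (r * T)\<^sup>2 \<le> 1 + r\<^sup>2"
        using that True by (metis abs_of_pos mult_pos_pos real_sqrt_abs real_sqrt_le_iff less_trans zero_less_one)
      also have "\<dots> \<longleftrightarrow> r\<^sup>2 \<le> R\<^sup>2"
        using T2 by (simp add: R field_simps)
      also have "\<dots> \<longleftrightarrow> r \<le> R"
        using that R(1) by (intro power_mono_iff) auto
      finally show ?thesis .
    qed
    then have "{r. 0 < r \<and> r * T \<le> sqrt (1 + r\<^sup>2)} = {0<..R}"
      by auto
    then have "?I = (\<integral>\<^sup>+r. ennreal (r / sqrt (1 + r\<^sup>2)) * indicator {0<..R} r \<partial>lborel)"
      unfolding I by simp
    also have "\<dots> = (\<integral>\<^sup>+r. ennreal (r / sqrt (1 + r\<^sup>2)) * indicator {0..R} r \<partial>lborel)"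
      using AE_lborel_singleton[of "0::real"]
      by (intro nn_integral_cong_AE, eventually_elim) (auto simp: indicator_def)
    also have "\<dots> = ennreal (sqrt (1 + R\<^sup>2) - 1)"
      using R by (intro radial_integral_Icc) simp
    also have "1 + R\<^sup>2 = T\<^sup>2 / (T\<^sup>2 - 1)"
      using T2 by (simp add: R field_simps)
    also have "sqrt \<dots> = T / sqrt (T\<^sup>2 - 1)"
      using True by (simp add: real_sqrt_divide)
    finally show ?thesis using True by simp
  next
    case False
    have "r * T \<le> sqrt (1 + r\<^sup>2)" if "r > 0" for r
    proof -
      have "r * T \<le> r * 1" using that False by (intro mult_left_mono) auto
      also have "\<dots> \<le> sqrt (1 + r\<^sup>2)" by (simp add: real_le_rsqrt)
      finally show ?thesis .
    qed
    then have "{r. 0 < r \<and> r * T \<le> sqrt (1 + r\<^sup>2)} = {0<..}" by auto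
    then have I': "?I = (\<integral>\<^sup>+r. ennreal (r / sqrt (1 + r\<^sup>2)) * indicator {0<..} r \<partial>lborel)"
      unfolding I by simp
    \<comment> \<open>The part of the ray up to radius n + 1 already contributes at least n.\<close>
    have "of_nat n \<le> ?I" for n
    proof -
      have "real n \<le> sqrt (1 + (real n + 1)\<^sup>2) - 1"
        using real_le_rsqrt[of "real n + 1" "1 + (real n + 1)\<^sup>2"] by simp
      then have "of_nat n \<le> ennreal (sqrt (1 + (real n + 1)\<^sup>2) - 1)"
        by (metis ennreal_leI ennreal_of_nat_eq_real_of_nat)
      also have "\<dots> = (\<integral>\<^sup>+r. ennreal (r / sqrt (1 + r\<^sup>2)) * indicator {0..real n + 1} r \<partial>lborel)"
        by (rule radial_integral_Icc[symmetric]) simp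
      also have "\<dots> \<le> ?I"
        unfolding I' by (intro nn_integral_mono) (auto simp: indicator_def)
      finally show ?thesis .
    qed
    then have "\<not> ?I < top"
      using ennreal_Ex_less_of_nat[of ?I] unfolding not_less[symmetric] by blast
    then have "?I = \<infinity>"
      by (simp add: less_top[symmetric])
    then show ?thesis using False by simp
  qed
qed

lemma height_polar: "height (r * cos t, r * sin t) = sqrt (1 + r\<^sup>2)"
proof -
  have "1 + (r * cos t)\<^sup>2 + (r * sin t)\<^sup>2 = 1 + r\<^sup>2 * ((cos t)\<^sup>2 + (sin t)\<^sup>2)"
    by (simp add: power_mult_distrib algebra_simps del: sin_cos_squared_add sin_cos_squared_add2)
  then show ?thesis by (simp add: height_def)
qed

lemma hyp_area_polar:
  "hyp_area (region N) = (\<integral>\<^sup>+t. indicator {-pi/2..3*pi/2} t *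
     (\<integral>\<^sup>+r. indicator {0<..} r * (ennreal r * (indicator {r. lift (r * cos t, r * sin t) \<in> region N} r
        * ennreal (1 / sqrt (1 + r\<^sup>2)))) \<partial>lborel) \<partial>lborel)"
  unfolding hyp_area_eq
  by (subst nn_integral_polar, measurable) (auto intro!: nn_integral_cong simp: indicator_def height_polar)

text \<open>Isolating \<open>A * cos t\<close> and squaring leaves a polynomial equation for
  \<open>sin t\<close> with leading coefficient \<open>A\<^sup>2 + B\<^sup>2\<close>, hence finitely
  many values of \<open>sin t\<close>; the sine is injective on each of the two halves of the
  circle.\<close>

lemma finite_trig_zeros:
  fixes A B C :: real
  assumes AB: "A \<noteq> 0 \<or> B \<noteq> 0"
  shows "finite {t \<in> {-pi/2..3*pi/2}. A * cos t + B * sin t = C}"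
proof -
  let ?X = "{x. poly [:C\<^sup>2 - A\<^sup>2, - 2 * B * C, A\<^sup>2 + B\<^sup>2:] x = 0}"
  have "finite ?X"
    using AB by (intro poly_roots_finite) (auto simp: add_nonneg_eq_0_iff)
  have X: "sin t \<in> ?X" if "A * cos t + B * sin t = C" for t
  proof -
    have "A * cos t = C - B * sin t" using that by simp
    then have "(A * cos t)\<^sup>2 = (C - B * sin t)\<^sup>2" by simp
    then have "A\<^sup>2 * (1 - (sin t)\<^sup>2) = (C - B * sin t)\<^sup>2" by (simp add: power_mult_distrib cos_squared_eq)
    then show ?thesis by (simp add: algebra_simps power2_eq_square)
  qed
  have "finite (sin -` ?X \<inter> {-pi/2..pi/2})"
    by (rule finite_vimage_IntI[OF \<open>finite ?X\<close>]) (auto intro!: inj_onI sin_inj_pi)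
  moreover have "finite (sin -` ?X \<inter> {pi/2..3*pi/2})"
  proof (rule finite_vimage_IntI[OF \<open>finite ?X\<close>], rule inj_onI)
    fix x y assume *: "x \<in> {pi/2..3*pi/2}" "y \<in> {pi/2..3*pi/2}" "sin x = sin y"
    have "pi - x = pi - y"
    proof (rule sin_inj_pi)
      show "sin (pi - x) = sin (pi - y)" using *(3) by simp
    qed (use *(1,2) in simp_all)
    then show "x = y" by simp
  qed
  ultimately have "finite ((sin -` ?X \<inter> {-pi/2..pi/2}) \<union> (sin -` ?X \<inter> {pi/2..3*pi/2}))"
    by blast
  then show ?thesis
    by (rule finite_subset[rotated]) (use X in auto)
qed

lemma continuous_on_Max:
  fixes f :: "'i \<Rightarrow> 'a::topological_space \<Rightarrow> 'b::linorder_topology"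
  assumes "finite I" "I \<noteq> {}" "\<And>i. i \<in> I \<Longrightarrow> continuous_on A (f i)"
  shows "continuous_on A (\<lambda>x. Max ((\<lambda>i. f i x) ` I))"
  using assms by (induction I rule: finite_ne_induct) (auto intro!: continuous_on_max)

text \<open>The fourth power makes a rotation by a right angle invisible.\<close>
lemma cis_4_arcsin_eq:
  assumes c: "c > 0" "c' > 0" and q: "q > 0"
    and S: "S\<^sup>2 = 1 - c\<^sup>2 * q" and S': "S'\<^sup>2 = 1 - c'\<^sup>2 * q" and SS': "S * S' = - c * c' * q"
  shows "cis (4 * arcsin S) = cis (4 * arcsin S')"
proof -
  have cis_arcsin: "cis (arcsin x) = Complex (sqrt (1 - x\<^sup>2)) x" if "x\<^sup>2 \<le> 1" for x
    using that by (simp add: complex_eq_iff cos_arcsin abs_square_le_1 abs_le_iff)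
  have "(1 - c\<^sup>2 * q) * (1 - c'\<^sup>2 * q) = (S * S')\<^sup>2" by (simp add: S S' power_mult_distrib)
  also have "\<dots> = c\<^sup>2 * c'\<^sup>2 * q\<^sup>2" by (simp add: SS' power_mult_distrib)
  \<comment> \<open>Hence \<open>S\<^sup>2 + S'\<^sup>2 = 1\<close>: the cosine of each arcsine is,
    up to sign, the sine of the other, so the two angles differ by a quarter turn. The sign of
    \<open>S\<close> decides its direction.\<close>
  finally have "q * (c\<^sup>2 + c'\<^sup>2) = 1" by (simp add: algebra_simps power2_eq_square)
  then have Sq: "S\<^sup>2 = (c' * sqrt q)\<^sup>2" and Sq': "1 - S\<^sup>2 = (c * sqrt q)\<^sup>2" and Sq'': "1 - S'\<^sup>2 = (c' * sqrt q)\<^sup>2"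
    using q S S' by (auto simp: power_mult_distrib algebra_simps)
  have z: "cis (arcsin S) = Complex (c * sqrt q) S" 
    using Sq' c q by (subst cis_arcsin) (auto simp: S)
  have z': "cis (arcsin S') = Complex (c' * sqrt q) S'"
    using Sq'' c q by (subst cis_arcsin) (auto simp: S')
  have "S = c' * sqrt q \<or> S = - (c' * sqrt q)"
    using Sq by (simp add: power2_eq_iff)
  then have "cis (arcsin S') = - \<i> * cis (arcsin S) \<or> cis (arcsin S') = \<i> * cis (arcsin S)"
  proof
    assume S: "S = c' * sqrt q"
    then have "(c' * sqrt q) * S' = (c' * sqrt q) * (- c * sqrt q)"
      using SS' q by (simp add: algebra_simps)
    then have "S' = - c * sqrt q"
      using c q by (subst (asm) mult_cancel_left) auto
    then show ?thesis unfolding z z' using S by (simp add: complex_eq_iff)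
  next
    assume S: "S = - (c' * sqrt q)"
    then have "(c' * sqrt q) * S' = (c' * sqrt q) * (c * sqrt q)"
      using SS' q by (simp add: algebra_simps)
    then have "S' = c * sqrt q"
      using c q by (subst (asm) mult_cancel_left) auto
    then show ?thesis unfolding z z' using S by (simp add: complex_eq_iff)
  qed
  then have "cis (arcsin S') ^ 4 = cis (arcsin S) ^ 4"
    by (auto simp: power_mult_distrib)
  then show ?thesis unfolding Complex.DeMoivre by simp
qed

section \<open>Polygons containing the base point\<close>

text \<open>Radial and (negated) angular components of the spatial part of \<open>u\<close> in direction \<open>t\<close>.\<close>
definition nrad :: "real^3 \<Rightarrow> real \<Rightarrow> real" where
  "nrad u t = u$1 * cos t + u$2 * sin t"

definition ntan :: "real^3 \<Rightarrow> real \<Rightarrow> real" where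
  "ntan u t = u$1 * sin t - u$2 * cos t"

lemma continuous_on_nrad [continuous_intros]: "continuous_on A (nrad u)"
  unfolding nrad_def by (intro continuous_intros)

lemma continuous_on_ntan [continuous_intros]: "continuous_on A (ntan u)"
  unfolding ntan_def by (intro continuous_intros)

lemma nrad_ntan_inner: "nrad u t * nrad v t + ntan u t * ntan v t = u$1 * v$1 + u$2 * v$2"
proof -
  have "nrad u t * nrad v t + ntan u t * ntan v t
      = (u$1 * v$1 + u$2 * v$2) * ((cos t)\<^sup>2 + (sin t)\<^sup>2)"
    by (simp add: nrad_def ntan_def algebra_simps power2_eq_square
        del: sin_cos_squared_add sin_cos_squared_add2 sin_cos_squared_add3)
  then show ?thesis by simp
qed

text \<open>The situation after an interior point has been moved to \<open>e\<^sub>3\<close>: the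
  Minkowski product of \<open>e\<^sub>3\<close> with \<open>u\<close> is \<open>- u$3\<close>, so
  \<open>pos\<close> places \<open>e\<^sub>3\<close> strictly inside every half-plane. Right angles
  appear as orthogonality of normals, the form supplied by \<open>right_angle_mink\<close>.\<close>

locale pointed_polygon =
  fixes N :: "(real^3) set"
  assumes fin: "finite N" and ne: "N \<noteq> {}"
    and unit: "u \<in> N \<Longrightarrow> mink u u = 1" and pos: "u \<in> N \<Longrightarrow> u$3 > 0"
    and right: "\<lbrakk>u \<in> N; v \<in> N; u \<noteq> v; p \<in> region N; mink p u = 0; mink p v = 0\<rbrakk> \<Longrightarrow> mink u v = 0"
    and finite_area: "hyp_area (region N) < \<infinity>"
begin

text \<open>Where \<open>T t > 1\<close>, the distance \<open>\<rho>\<close> to the boundary in direction \<open>t\<close> satisfies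
  \<open>tanh \<rho> = 1 / T t\<close>; where \<open>T t \<le> 1\<close>, the ray never leaves the polygon.\<close>
definition T :: "real \<Rightarrow> real" where
  "T t = Max ((\<lambda>u. nrad u t / u$3) ` N)"

lemma T_ge: "u \<in> N \<Longrightarrow> nrad u t / u$3 \<le> T t"
  unfolding T_def using fin by (intro Max_ge) auto

lemma T_attained: obtains u where "u \<in> N" "nrad u t / u$3 = T t"
proof -
  have "T t \<in> (\<lambda>u. nrad u t / u$3) ` N"
    unfolding T_def using fin ne by (intro Max_in) auto
  then show ?thesis using that by auto
qed

lemma continuous_on_T [continuous_intros]: "continuous_on A T"
  unfolding T_def using fin ne pos
  by (intro continuous_on_Max continuous_intros) (auto, metis less_irrefl)

lemma measurable_T [measurable]: "T \<in> borel_measurable borel"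
  by (intro borel_measurable_continuous_onI continuous_intros)

lemma nrad_ntan: "u \<in> N \<Longrightarrow> (nrad u t)\<^sup>2 + (ntan u t)\<^sup>2 = 1 + (u$3)\<^sup>2"
  using nrad_ntan_inner[of u t u] unit[of u] by (simp add: mink_def power2_eq_square)

lemma lift_polar_in_region:
  assumes "r > 0"
  shows "lift (r * cos t, r * sin t) \<in> region N \<longleftrightarrow> r * T t \<le> sqrt (1 + r\<^sup>2)"
proof -
  have "lift (r * cos t, r * sin t) \<in> region N \<longleftrightarrow> (\<forall>u\<in>N. nrad u t / u$3 \<le> sqrt (1 + r\<^sup>2) / r)"
    unfolding lift_in_region using pos assms
    by (intro ball_cong refl) (simp add: height_polar nrad_def field_simps)
  also have "\<dots> \<longleftrightarrow> T t \<le> sqrt (1 + r\<^sup>2) / r"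
    unfolding T_def using fin ne by (subst Max_le_iff) auto
  finally show ?thesis using assms by (simp add: field_simps)
qed

lemma ntan_squared:
  "u \<in> N \<Longrightarrow> nrad u t / u$3 = T t \<Longrightarrow> (ntan u t)\<^sup>2 = 1 - (u$3)\<^sup>2 * ((T t)\<^sup>2 - 1)"
  using nrad_ntan[of u t] pos[of u] by (auto simp: field_simps)

text \<open>If \<open>T t = 1\<close>, the ray runs to an ideal point, both arcsines are
  \<open>pi/2\<close> up to sign, and the factor 4 makes both values 1. If \<open>T t > 1\<close>,
  the ray meets both sides in one finite boundary point, so the sides are orthogonal and the
  arcsines differ by a quarter turn.\<close>

lemma cis_ntan_eq:
  assumes u: "u \<in> N" "nrad u t / u$3 = T t" and v: "v \<in> N" "nrad v t / v$3 = T t" and T: "T t \<ge> 1"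
  shows "cis (4 * arcsin (ntan u t)) = cis (4 * arcsin (ntan v t))"
proof (cases "u = v")
  case False
  show ?thesis
  proof (cases "T t = 1")
    case True
    have "cis (4 * arcsin (ntan w t)) = 1" if "w \<in> N" "nrad w t / w$3 = T t" for w
    proof -
      have "(ntan w t)\<^sup>2 = 1" using ntan_squared[OF that] True by simp
      then have "ntan w t = 1 \<or> ntan w t = -1" by (simp add: power2_eq_1_iff)
      moreover have "cis (4 * (pi/2)) = 1" "cis (4 * - (pi/2)) = 1"
        by (simp_all add: complex_eq_iff)
      ultimately show ?thesis by auto
    qed
    then show ?thesis using u v by simp
  next
    case False
    then have T1: "T t > 1" using T by simp
    then have T2: "(T t)\<^sup>2 - 1 > 0" by (simp add: one_less_power)
    \<comment> \<open>\<open>R\<close> is the hyperbolic sine of the distance to the boundary, so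
      \<open>?p\<close> below is the point where the ray leaves the polygon.\<close>
    define R where "R = 1 / sqrt ((T t)\<^sup>2 - 1)"
    have R: "R > 0" using T2 by (simp add: R_def)
    have "1 + R\<^sup>2 = (T t)\<^sup>2 * R\<^sup>2"
      using T2 by (simp add: R_def power_divide field_simps)
    then have RT: "sqrt (1 + R\<^sup>2) = R * T t"
      using R T1 by (simp add: real_sqrt_mult)
    let ?p = "lift (R * cos t, R * sin t)"
    have p: "?p \<in> region N" using R RT by (simp add: lift_polar_in_region)
    have mink_p: "mink ?p w = 0" if "w \<in> N" "nrad w t / w$3 = T t" for w
    proof -
      have "nrad w t = T t * w$3" using that pos[of w] by (auto simp: field_simps)
      then have "R * nrad w t = R * T t * w$3" by simp
      then show ?thesis by (simp add: mink_def height_polar RT nrad_def algebra_simps)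
    qed
    have "mink u v = 0"
      using right[OF u(1) v(1) \<open>u \<noteq> v\<close> p] mink_p u v by simp
    then have "ntan u t * ntan v t = u$3 * v$3 - nrad u t * nrad v t"
      using nrad_ntan_inner[of u t v] by (simp add: mink_def)
    moreover have "nrad u t = T t * u$3" "nrad v t = T t * v$3"
      using u v pos[OF u(1)] pos[OF v(1)] by (simp_all add: field_simps)
    ultimately have "ntan u t * ntan v t = - u$3 * v$3 * ((T t)\<^sup>2 - 1)"
      by (simp add: algebra_simps power2_eq_square)
    then show ?thesis
      using T2 u v pos ntan_squared by (intro cis_4_arcsin_eq[of "u$3" "v$3" "(T t)\<^sup>2 - 1"]) auto
  qed
qed simp

section \<open>The area as an integral over directions\<close>

abbreviation (input) circ :: "real set" where "circ \<equiv> {-pi/2..3*pi/2}"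

text \<open>The quotient is \<open>cosh \<rho>\<close> for \<open>tanh \<rho> = 1 / T t\<close>.
  Where \<open>T t \<le> 1\<close> the distance is infinite and 1 is a default; for a finite area
  this concerns only a null set of directions in \<open>circ\<close>.\<close>

definition cosh_rho :: "real \<Rightarrow> real" where
  "cosh_rho t = (if T t > 1 then T t / sqrt ((T t)\<^sup>2 - 1) else 1)"

lemma measurable_cosh_rho [measurable]: "cosh_rho \<in> borel_measurable borel"
  unfolding cosh_rho_def by measurable

lemma cosh_rho_gt_1: "T t > 1 \<Longrightarrow> cosh_rho t > 1"
proof -
  assume "T t > 1"
  then have "(T t)\<^sup>2 - 1 > 0" by (simp add: one_less_power)
  moreover have "sqrt ((T t)\<^sup>2 - 1) < sqrt ((T t)\<^sup>2)" by (rule real_sqrt_less_mono) simp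
  ultimately show ?thesis using \<open>T t > 1\<close> by (simp add: cosh_rho_def)
qed

lemma cosh_rho_ge_1: "cosh_rho t \<ge> 1"
  using cosh_rho_gt_1[of t] by (cases "T t > 1") (auto simp: cosh_rho_def)

lemma area_T: "hyp_area (region N) =
  (\<integral>\<^sup>+t. indicator circ t * (if T t > 1 then ennreal (cosh_rho t - 1) else \<infinity>) \<partial>lborel)"
  unfolding hyp_area_polar
proof (intro nn_integral_cong arg_cong2[where f = "(*)"] refl)
  fix t
  have "(\<integral>\<^sup>+r. indicator {0<..} r * (ennreal r * (indicator {r. lift (r * cos t, r * sin t) \<in> region N} r
        * ennreal (1 / sqrt (1 + r\<^sup>2)))) \<partial>lborel) =
     (\<integral>\<^sup>+r. indicator {0<..} r * (ennreal r * (indicator {r. r * T t \<le> sqrt (1 + r\<^sup>2)} r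
        * ennreal (1 / sqrt (1 + r\<^sup>2)))) \<partial>lborel)"
    by (intro nn_integral_cong) (auto simp: indicator_def lift_polar_in_region)
  then show "(\<integral>\<^sup>+r. indicator {0<..} r * (ennreal r * (indicator {r. lift (r * cos t, r * sin t) \<in> region N} r
        * ennreal (1 / sqrt (1 + r\<^sup>2)))) \<partial>lborel) = (if T t > 1 then ennreal (cosh_rho t - 1) else \<infinity>)"
    by (simp add: radial_integral cosh_rho_def)
qed

text \<open>A ray that never leaves the polygon has an infinite radial integral, so finite area
  forces such directions to form a null set.\<close>

lemma AE_T_gt_1: "AE t in lborel. t \<in> circ \<longrightarrow> T t > 1"
proof -
  let ?f = "\<lambda>t. indicator circ t * (if T t > 1 then ennreal (cosh_rho t - 1) else \<infinity>)"
  have "?f \<in> borel_measurable lborel" by measurable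
  moreover have "integral\<^sup>N lborel ?f \<noteq> \<infinity>"
    using finite_area area_T by simp
  ultimately have "AE t in lborel. ?f t \<noteq> \<infinity>" by (rule nn_integral_PInf_AE)
  then show ?thesis
  proof eventually_elim
    case (elim t)
    then show ?case by (cases "T t > 1"; cases "t \<in> circ") (simp_all only: indicator_simps, simp_all)
  qed
qed

text \<open>By continuity of \<open>T\<close>, one direction with \<open>T t < 1\<close> would bring
  a nonempty open set of them, which is not null. Geometrically, finite area excludes an arc on the
  boundary at infinity.\<close>

lemma T_ge_1: "t \<in> circ \<Longrightarrow> T t \<ge> 1"
proof (rule ccontr)
  assume t: "t \<in> circ" and "\<not> T t \<ge> 1"
  let ?U = "{t. T t < 1} \<inter> {-pi/2<..<3*pi/2}"
  have op: "open {t. T t < 1}"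
    by (intro open_Collect_less continuous_intros)
  moreover have "closure {-pi/2<..<3*pi/2} = circ"
    by (intro closure_greaterThanLessThan) simp
  ultimately have "?U \<noteq> {}"
    using t \<open>\<not> T t \<ge> 1\<close> open_Int_closure_eq_empty[of "{t. T t < 1}" "{-pi/2<..<3*pi/2}"]
    by (metis (mono_tags) IntI empty_iff mem_Collect_eq not_le)
  moreover have "open ?U" using op by auto
  ultimately have "\<not> negligible ?U"
    using open_not_negligible by blast
  moreover have "AE t in lebesgue. t \<notin> ?U"
    using AE_T_gt_1 by (intro AE_completion) (auto elim!: eventually_mono)
  then have "?U \<in> null_sets lebesgue"
    using \<open>open ?U\<close> by (subst AE_iff_null_sets) auto
  ultimately show False
    by (simp add: negligible_iff_null_sets)
qed

lemma area_cosh_rho: "hyp_area (region N) = (\<integral>\<^sup>+t. ennreal (indicator circ t * (cosh_rho t - 1)) \<partial>lborel)"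
  unfolding area_T using AE_T_gt_1
  by (intro nn_integral_cong_AE, eventually_elim) (auto simp: indicator_def)

lemma area_pos: "hyp_area (region N) > 0"
proof (rule ccontr)
  assume "\<not> hyp_area (region N) > 0"
  then have "hyp_area (region N) = 0" by (simp add: zero_less_iff_neq_zero)
  then have "AE t in lborel. ennreal (indicator circ t * (cosh_rho t - 1)) = 0"
    unfolding area_cosh_rho by (subst (asm) nn_integral_0_iff_AE) auto
  then have "AE t in lborel. t \<notin> circ"
    using AE_T_gt_1
  proof eventually_elim
    case (elim t)
    then show ?case using cosh_rho_gt_1[of t] by (auto simp: indicator_def ennreal_eq_0_iff)
  qed
  then have "circ \<in> null_sets lborel" by (subst AE_iff_null_sets) auto
  then show False by (auto simp: null_sets_def)
qed

lemma cosh_rho_has_integral: 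
  "(cosh_rho has_integral enn2real (hyp_area (region N)) + 2 * pi) circ"
proof -
  have "((\<lambda>t. indicator circ t * (cosh_rho t - 1)) has_integral enn2real (hyp_area (region N))) UNIV"
    using finite_area cosh_rho_ge_1 unfolding area_cosh_rho by (intro nn_integral_has_integral) auto
  also have "(\<lambda>t. indicator circ t * (cosh_rho t - 1)) = (\<lambda>t. if t \<in> circ then cosh_rho t - 1 else 0)"
    by (auto simp: indicator_def)
  finally have "((\<lambda>t. cosh_rho t - 1) has_integral enn2real (hyp_area (region N))) circ"
    by (simp only: has_integral_restrict_UNIV)
  from has_integral_add[OF this has_integral_const_real[of 1 "-pi/2" "3*pi/2"]] show ?thesis
    by simp
qed

text \<open>Besides the directions of finite and ideal vertices this contains those where two tied
  geodesics lie beyond the boundary of the polygon. Off this set exactly one side attains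
  \<open>T t\<close>, and \<open>T t > 1\<close> on \<open>circ\<close>.\<close>

definition corners :: "real set" where
  "corners = {t \<in> circ. T t = 1 \<or> (\<exists>u\<in>N. \<exists>v\<in>N. u \<noteq> v \<and> nrad u t / u$3 = nrad v t / v$3)}"

text \<open>Each condition is a trigonometric equation that could degenerate only if the spatial
  part of \<open>u\<close> vanished, impossible for a unit spacelike vector, or if \<open>u\<close>
  and \<open>v\<close> were proportional; their norm and \<open>pos\<close> would then force
  \<open>u = v\<close>.\<close>

lemma finite_corners: "finite corners"
proof -
  have 1: "finite {t \<in> circ. nrad u t = u$3}" if "u \<in> N" for u
  proof -
    have "u$1 \<noteq> 0 \<or> u$2 \<noteq> 0"
    proof (rule ccontr)
      assume "\<not> ?thesis"
      then show False using unit[OF that] zero_le_square[of "u$3"] unfolding mink_def by simp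
    qed
    from finite_trig_zeros[OF this, of "u$3"] show ?thesis by (simp add: nrad_def)
  qed
  have 2: "finite {t \<in> circ. nrad u t / u$3 = nrad v t / v$3}" if "u \<in> N" "v \<in> N" "u \<noteq> v" for u v
  proof -
    note upos = pos[OF that(1)] pos[OF that(2)]
    have "u$1 / u$3 - v$1 / v$3 \<noteq> 0 \<or> u$2 / u$3 - v$2 / v$3 \<noteq> 0"
    proof (rule ccontr)
      assume "\<not> ?thesis"
      then have e: "u$1 / u$3 = v$1 / v$3" "u$2 / u$3 = v$2 / v$3" by auto
      have "(w$1 / w$3)\<^sup>2 + (w$2 / w$3)\<^sup>2 - 1 = 1 / (w$3)\<^sup>2" if "w \<in> N" for w
        using unit[OF that] pos[OF that] 
        by (simp add: mink_def power2_eq_square field_simps)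
      from this[OF that(1)] this[OF that(2)] e have "(u$3)\<^sup>2 = (v$3)\<^sup>2" by simp
      then have "u$3 = v$3" using upos by (simp add: power2_eq_iff)
      then show False using e upos \<open>u \<noteq> v\<close> by (auto simp: vec_eq_iff forall_3)
    qed
    from finite_trig_zeros[OF this, of 0] show ?thesis
      by (simp add: nrad_def algebra_simps add_divide_distrib)
  qed
  have "corners \<subseteq> (\<Union>u\<in>N. {t \<in> circ. nrad u t = u$3}) \<union>
     (\<Union>u\<in>N. \<Union>v\<in>N - {u}. {t \<in> circ. nrad u t / u$3 = nrad v t / v$3})"
  proof
    fix t assume t: "t \<in> corners"
    obtain u where "u \<in> N" "nrad u t / u$3 = T t" by (rule T_attained)
    then show "t \<in> (\<Union>u\<in>N. {t \<in> circ. nrad u t = u$3}) \<union>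
     (\<Union>u\<in>N. \<Union>v\<in>N - {u}. {t \<in> circ. nrad u t / u$3 = nrad v t / v$3})"
    proof (cases "T t = 1")
      case True
      then have "nrad u t = u$3" using \<open>u \<in> N\<close> \<open>nrad u t / u$3 = T t\<close> pos[of u] by simp
      then show ?thesis using t \<open>u \<in> N\<close> unfolding corners_def by blast
    next
      case False
      then show ?thesis using t unfolding corners_def by blast
    qed
  qed
  then show ?thesis
  proof (rule finite_subset)
    show "finite ((\<Union>u\<in>N. {t \<in> circ. nrad u t = u$3}) \<union>
      (\<Union>u\<in>N. \<Union>v\<in>N - {u}. {t \<in> circ. nrad u t / u$3 = nrad v t / v$3}))"
      by (intro finite_UnI finite_UN_I finite_Diff fin 1 2) blast+
  qed
qed

section \<open>The turning function and its rate of change\<close>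

definition side :: "real \<Rightarrow> real^3" where
  "side t = (SOME u. u \<in> N \<and> nrad u t / u$3 = T t)"

lemma side: "side t \<in> N" "nrad (side t) t / side t $ 3 = T t"
  using someI_ex[of "\<lambda>u. u \<in> N \<and> nrad u t / u$3 = T t"] T_attained[of t] unfolding side_def by blast+

text \<open>At a corner \<open>side t\<close> is an arbitrary choice among the sides attaining
  \<open>T t\<close>; \<open>cis_ntan_eq\<close> makes the value independent of it on
  \<open>circ\<close>. The factor 4 turns the jumps \<open>pi/2\<close> and \<open>pi\<close> of the
  arcsine into multiples of \<open>2 * pi\<close>.\<close>

definition turning :: "real \<Rightarrow> complex" where
  "turning t = cis (4 * arcsin (ntan (side t) t))"

lemma turning_eq: "u \<in> N \<Longrightarrow> nrad u t / u$3 = T t \<Longrightarrow> t \<in> circ \<Longrightarrow> turning t = cis (4 * arcsin (ntan u t))"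
  unfolding turning_def by (intro cis_ntan_eq side T_ge_1)

lemma abs_ntan_le_1: "u \<in> N \<Longrightarrow> nrad u t / u$3 = T t \<Longrightarrow> t \<in> circ \<Longrightarrow> \<bar>ntan u t\<bar> \<le> 1"
  using ntan_squared[of u t] T_ge_1[of t] by (simp add: abs_square_le_1[symmetric])

text \<open>The circle is a finite union of closed sets, one for each side attaining
  \<open>T\<close>; on each of them a single continuous formula gives \<open>turning\<close>, and
  the pieces are pasted together.\<close>

lemma continuous_on_turning: "continuous_on circ turning"
proof -
  let ?C = "\<lambda>u. {t \<in> circ. nrad u t / u$3 = T t}"
  have "continuous_on (\<Union>u\<in>N. ?C u) turning"
  proof (rule continuous_on_closed_Union[OF fin])
    fix u assume u: "u \<in> N"
    have "?C u = circ \<inter> {t. nrad u t / u$3 = T t}" by auto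
    also have "closed \<dots>"
      using pos[OF u] by (intro closed_Int closed_atLeastAtMost closed_Collect_eq continuous_intros) auto
    finally show "closed (?C u)" .
    have "continuous_on (?C u) (\<lambda>t. cis (4 * arcsin (ntan u t)))"
      using abs_ntan_le_1[OF u] by (intro continuous_intros) (auto simp: abs_le_iff)
    then show "continuous_on (?C u) turning"
      by (rule continuous_on_eq) (use turning_eq[OF u] in auto)
  qed
  moreover have "(\<Union>u\<in>N. ?C u) = circ"
    using side by fast
  ultimately show ?thesis by simp
qed

text \<open>Near such a \<open>t\<close> a single side \<open>u\<close> attains \<open>T\<close>.
  From \<open>nrad u t = T t * u$3\<close> and
  \<open>1 - (ntan u t)\<^sup>2 = (u$3)\<^sup>2 * ((T t)\<^sup>2 - 1)\<close> the derivative of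
  \<open>arcsin (ntan u s)\<close> at \<open>t\<close> is \<open>cosh_rho t\<close>, so the two
  phases cancel to first order.\<close>

lemma turning_integral_has_derivative_0:
  assumes t: "t \<in> circ - corners"
  shows "((\<lambda>s. turning s * cis (- 4 * integral {-pi/2..s} cosh_rho)) has_derivative (\<lambda>_. 0)) (at t within circ)"
proof -
  define u where "u = side t"
  have u: "u \<in> N" "nrad u t / u$3 = T t" unfolding u_def by (rule side)+
  have u3: "u$3 > 0" using pos[OF u(1)] .
  have T1: "T t > 1" using t T_ge_1[of t] unfolding corners_def by force
  \<comment> \<open>The set where \<open>u\<close> strictly beats all other sides and
    \<open>cosh_rho\<close> stays on its first branch; finiteness of \<open>N\<close> makes it
    open.\<close>
  define U where "U = (\<Inter>v\<in>N - {u}. {s. nrad v s / v$3 < nrad u s / u$3}) \<inter> {s. T s > 1}"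
  have "open U"
    unfolding U_def using fin pos u(1)
    by (intro open_Int open_INT ballI open_Collect_less continuous_intros) (auto, (metis less_irrefl)+)
  moreover have "t \<in> U"
  proof -
    have "nrad v t / v$3 < nrad u t / u$3" if "v \<in> N - {u}" for v
      using that u t T_ge[of v t] unfolding corners_def by force
    then show ?thesis using T1 by (simp add: U_def)
  qed
  ultimately obtain d where d: "d > 0" "\<And>s. dist s t < d \<Longrightarrow> s \<in> U"
    by (metis open_dist)
  have T_eq: "nrad u s / u$3 = T s" if "s \<in> U" for s
  proof -
    obtain w where w: "w \<in> N" "nrad w s / w$3 = T s" by (rule T_attained)
    have "w = u"
    proof (rule ccontr)
      assume "w \<noteq> u"
      then have "nrad w s / w$3 < nrad u s / u$3" using that w(1) unfolding U_def by blast
      then show False using w(2) T_ge[OF u(1), of s] by simp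
    qed
    then show ?thesis using w(2) by simp
  qed
  have T2: "(T t)\<^sup>2 - 1 > 0" using T1 by (simp add: one_less_power)
  have ntan2: "1 - (ntan u t)\<^sup>2 = (u$3)\<^sup>2 * ((T t)\<^sup>2 - 1)"
    using ntan_squared[OF u] by simp
  then have "(ntan u t)\<^sup>2 < 1"
    using T2 u3 by (smt (verit) mult_pos_pos zero_less_power)
  then have ntan1: "-1 < ntan u t" "ntan u t < 1"
    by (auto simp: abs_square_less_1 abs_less_iff)
  have "(ntan u has_real_derivative nrad u t) (at t within circ)"
    unfolding ntan_def nrad_def by (auto intro!: derivative_eq_intros)
  then have "((\<lambda>s. arcsin (ntan u s)) has_real_derivative
      inverse (sqrt (1 - (ntan u t)\<^sup>2)) * nrad u t) (at t within circ)"
    by (rule DERIV_chain2[where g = "ntan u", OF DERIV_arcsin[OF ntan1]])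
  also have "inverse (sqrt (1 - (ntan u t)\<^sup>2)) * nrad u t = cosh_rho t"
  proof -
    have "nrad u t = T t * u$3" using u u3 by (simp add: field_simps)
    moreover have "sqrt ((u$3)\<^sup>2 * ((T t)\<^sup>2 - 1)) = u$3 * sqrt ((T t)\<^sup>2 - 1)"
      using u3 by (simp only: real_sqrt_mult real_sqrt_abs abs_of_pos)
    ultimately show ?thesis
      using T1 u3 unfolding ntan2 by (simp add: cosh_rho_def divide_inverse)
  qed
  finally have 1: "((\<lambda>s. arcsin (ntan u s)) has_real_derivative cosh_rho t) (at t within circ)" .
  have "continuous (at t within circ) cosh_rho"
  proof -
    have "continuous_on U (\<lambda>s. T s / sqrt ((T s)\<^sup>2 - 1))"
    proof (intro continuous_intros ballI)
      fix s assume "s \<in> U"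
      then have "(T s)\<^sup>2 > 1" by (simp add: U_def one_less_power)
      then show "sqrt ((T s)\<^sup>2 - 1) \<noteq> 0" by simp
    qed
    then have "continuous_on U cosh_rho"
      by (rule continuous_on_eq) (simp add: U_def cosh_rho_def)
    then have "isCont cosh_rho t"
      using \<open>open U\<close> \<open>t \<in> U\<close> by (simp add: continuous_on_eq_continuous_at)
    then show ?thesis by (rule continuous_at_imp_continuous_at_within)
  qed
  then have 2: "((\<lambda>s. integral {-pi/2..s} cosh_rho) has_real_derivative cosh_rho t) (at t within circ)"
    using integral_has_vector_derivative_continuous_at[of cosh_rho "-pi/2" "3*pi/2" t "{}"]
      has_integral_integrable[OF cosh_rho_has_integral] t
    by (simp add: has_real_derivative_iff_has_vector_derivative)
  have "((\<lambda>s. 4 * (arcsin (ntan u s) - integral {-pi/2..s} cosh_rho)) has_real_derivative 4 * (cosh_rho t - cosh_rho t)) (at t within circ)"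
    by (intro DERIV_cmult DERIV_diff 1 2)
  then have "((\<lambda>s. 4 * (arcsin (ntan u s) - integral {-pi/2..s} cosh_rho)) has_derivative (\<lambda>_. 0)) (at t within circ)"
    by (simp add: has_field_derivative_def lambda_zero[symmetric])
  from has_derivative_cis[OF this]
  have "((\<lambda>s. cis (4 * (arcsin (ntan u s) - integral {-pi/2..s} cosh_rho))) has_derivative (\<lambda>_. 0)) (at t within circ)"
    by simp
  then show ?thesis
  proof (rule has_derivative_transform_within[OF _ d(1)])
    show "t \<in> circ" using t by simp
    fix s assume s: "s \<in> circ" "dist s t < d"
    have "turning s = cis (4 * arcsin (ntan u s))"
      using s d T_eq by (intro turning_eq[OF u(1)]) auto
    then show "cis (4 * (arcsin (ntan u s) - integral {-pi/2..s} cosh_rho)) = turning s * cis (- 4 * integral {-pi/2..s} cosh_rho)"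
      by (simp add: cis_mult algebra_simps)
  qed
qed

lemma turning_periodic: "turning (3*pi/2) = turning (-pi/2)"
proof -
  have sc: "sin (3*pi/2) = sin (-pi/2)" "cos (3*pi/2) = cos (-pi/2)"
    using sin_periodic[of "-pi/2"] cos_periodic[of "-pi/2"] by (simp_all add: algebra_simps)
  have "nrad u (3*pi/2) = nrad u (-pi/2)" "ntan u (3*pi/2) = ntan u (-pi/2)" for u
    unfolding nrad_def ntan_def sc by auto
  \<comment> \<open>The predicate under the choice operator in \<open>side\<close> is the same at
    both endpoints, hence so is the chosen side.\<close>
  then show ?thesis unfolding turning_def side_def T_def by simp
qed

lemma area_ge: "hyp_area (region N) \<ge> ennreal (pi / 2)"
proof -
  define a where "a = enn2real (hyp_area (region N))"
  let ?G = "\<lambda>s. turning s * cis (- 4 * integral {-pi/2..s} cosh_rho)"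
  have int: "integral circ cosh_rho = a + 2 * pi"
    using cosh_rho_has_integral unfolding a_def by (rule integral_unique)
  have "continuous_on circ ?G"
    using has_integral_integrable[OF cosh_rho_has_integral]
    by (intro continuous_intros continuous_on_turning indefinite_integral_continuous_1)
  \<comment> \<open>A continuous function whose derivative vanishes off a finite set is
    constant.\<close>
  then have "?G (3*pi/2) = ?G (-pi/2)"
    by (rule has_derivative_zero_unique_strong_interval[OF finite_corners _ refl turning_integral_has_derivative_0]) auto
  then have "turning (-pi/2) * cis (- 4 * (a + 2 * pi)) = turning (-pi/2)"
    by (simp only: turning_periodic int) simp
  moreover have "turning (-pi/2) \<noteq> 0" by (simp add: turning_def)
  ultimately have "cis (- 4 * (a + 2 * pi)) = 1" by simp
  then obtain n :: int where n: "- 4 * (a + 2 * pi) = of_int n * (2 * pi)"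
    unfolding cis_eq_1_iff by blast
  \<comment> \<open>The total angle \<open>2 * pi\<close>, four times \<open>pi / 2\<close>,
    accounts for the shift by 4.\<close>
  then have a: "a = of_int (- n - 4) * (pi / 2)" by (simp add: field_simps)
  have area: "hyp_area (region N) = ennreal a" using finite_area by (simp add: a_def)
  then have "a > 0" using area_pos by (simp add: ennreal_less_zero_iff)
  then have "real_of_int (- n - 4) > 0" unfolding a by (simp add: zero_less_mult_iff)
  then have "- n - 4 \<ge> 1" by linarith
  then have "1 * (pi / 2) \<le> of_int (- n - 4) * (pi / 2)"
    by (intro mult_right_mono) (simp_all only: of_int_1_le_iff, simp)
  then show ?thesis unfolding area a by (intro ennreal_leI) simp
qed

end

section \<open>The triangle and the minimality theorem\<close>

text \<open>The last vector is orthogonal to both ideal vertices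
  \<open>e\<^sub>1 + e\<^sub>3\<close> and \<open>e\<^sub>2 + e\<^sub>3\<close>, so it is the normal
  of the side joining them.\<close>

definition P2_normals :: "(real^3) set" where
  "P2_normals = {vector [-1, 0, 0], vector [0, -1, 0], vector [1, 1, 1]}"

lemma P2_eq_region: "P2 = region P2_normals"
  by (auto simp: P2_def region_def P2_normals_def mink_def)

lemma hyp_polygon_P2: "hyp_polygon P2_normals P2"
  unfolding hyp_polygon_def
proof (intro conjI ballI)
  show "finite P2_normals" by (simp add: P2_normals_def)
  show "mink u u = 1" if "u \<in> P2_normals" for u
    using that by (auto simp: P2_normals_def mink_def)
  show "P2 = {x \<in> H2. \<forall>u\<in>P2_normals. mink x u \<le> 0}"
    by (simp add: P2_eq_region region_def)
  \<comment> \<open>A rational interior point on the diagonal, from 4^2 + 4^2 + 7^2 = 9^2.\<close>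
  show "\<exists>x\<in>H2. \<forall>u\<in>P2_normals. mink x u < 0"
    by (rule bexI[of _ "vector [4/7, 4/7, 9/7]"])
       (auto simp: P2_normals_def mink_def H2_def power2_eq_square)
  fix u assume "u \<in> P2_normals"
  then consider "u = vector [-1, 0, 0]" | "u = vector [0, -1, 0]" | "u = vector [1, 1, 1]"
    by (auto simp: P2_normals_def)
  \<comment> \<open>Rational points on the sides: the vertex \<open>e\<^sub>3\<close> and a point
    from 3^2 + 4^2 = 5^2 on the first two, points from 1^2 + 2^2 + 2^2 = 3^2 on the third.\<close>
  then show "\<exists>x y. x \<noteq> y \<and> x \<in> P2 \<and> y \<in> P2 \<and> mink x u = 0 \<and> mink y u = 0"
  proof cases
    case 1
    then show ?thesis
      by (intro exI[of _ "vector [0, 0, 1]"] exI[of _ "vector [0, 3/4, 5/4]"])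
         (auto simp: P2_def H2_def mink_def vec_eq_iff forall_3 power2_eq_square)
  next
    case 2
    then show ?thesis
      by (intro exI[of _ "vector [0, 0, 1]"] exI[of _ "vector [3/4, 0, 5/4]"])
         (auto simp: P2_def H2_def mink_def vec_eq_iff forall_3 power2_eq_square)
  next
    case 3
    then show ?thesis
      by (intro exI[of _ "vector [1, 1/2, 3/2]"] exI[of _ "vector [1/2, 1, 3/2]"])
         (auto simp: P2_def H2_def mink_def vec_eq_iff forall_3 power2_eq_square)
  qed
qed

text \<open>The third side meets neither of the others in \<open>H2\<close>: at such a point one
  spatial coordinate would vanish and the other equal \<open>p$3\<close>, against the equation of
  the hyperboloid. Only the pair of orthogonal axes remains.\<close>

lemma P2_angle:
  assumes "u \<in> P2_normals" "v \<in> P2_normals" "p \<in> P2" "u \<noteq> v" "mink p u = 0" "mink p v = 0"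
  shows "interior_angle u v = pi / 2"
proof -
  have no: "False" if "x\<^sup>2 - z\<^sup>2 = -1" "x = z" for x z :: real
    using that by simp
  have p: "(p$1)\<^sup>2 + (p$2)\<^sup>2 - (p$3)\<^sup>2 = -1" using assms(3) by (simp add: P2_def H2_def)
  have "mink u v = 0"
    using assms(1,2,4,5,6) p no[of "p$1" "p$3"] no[of "p$2" "p$3"]
    by (auto simp: P2_normals_def mink_def)
  then show ?thesis by (simp add: interior_angle_def)
qed

text \<open>Here the base point of the polar coordinates is the vertex \<open>e\<^sub>3\<close>. For
  \<open>0 < t < pi/2\<close> only the third side stops the ray, with \<open>cos t + sin t\<close>
  in the role of \<open>T\<close>; almost all other rays miss the triangle beyond
  \<open>e\<^sub>3\<close>.\<close>

lemma hyp_area_P2: "hyp_area P2 = ennreal (pi / 2)"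
proof -
  let ?T = "\<lambda>t. cos t + sin t :: real"
  let ?f = "\<lambda>t. ?T t / sqrt ((?T t)\<^sup>2 - 1) - 1"
  have T2: "(?T t)\<^sup>2 - 1 = 2 * (sin t * cos t)" "1 - (sin t - cos t)\<^sup>2 = 2 * (sin t * cos t)" for t :: real
    using sin_cos_squared_add[of t] by (simp_all add: power2_eq_square algebra_simps)
  have T1: "?T t > 1" if "t \<in> {0<..<pi/2}" for t
  proof -
    have "sin t > 0" "cos t > 0" using that by (auto intro: sin_gt_zero cos_gt_zero)
    then have "(?T t)\<^sup>2 - 1 > 0" unfolding T2 by simp
    then show ?thesis using \<open>sin t > 0\<close> \<open>cos t > 0\<close> by (intro power2_less_imp_less[of 1]) auto
  qed
  have inner: "(\<integral>\<^sup>+r. indicator {0<..} r * (ennreal r * (indicator {r. lift (r * cos t, r * sin t) \<in> P2} r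
        * ennreal (1 / sqrt (1 + r\<^sup>2)))) \<partial>lborel) = ennreal (?f t) * indicator {0<..<pi/2} t"
    if t: "t \<in> {-pi/2..3*pi/2}" "t \<noteq> 0" "t \<noteq> pi/2" "t \<noteq> 3*pi/2" for t
  proof (cases "t \<in> {0<..<pi/2}")
    case True
    have "sin t > 0" "cos t > 0" using True by (auto intro: sin_gt_zero cos_gt_zero)
    then have "lift (r * cos t, r * sin t) \<in> P2 \<longleftrightarrow> r * ?T t \<le> sqrt (1 + r\<^sup>2)" if "r > 0" for r
      using that by (simp add: P2_def height_polar algebra_simps)
    then have "(\<integral>\<^sup>+r. indicator {0<..} r * (ennreal r * (indicator {r. lift (r * cos t, r * sin t) \<in> P2} r
        * ennreal (1 / sqrt (1 + r\<^sup>2)))) \<partial>lborel) =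
      (\<integral>\<^sup>+r. indicator {0<..} r * (ennreal r * (indicator {r. r * ?T t \<le> sqrt (1 + r\<^sup>2)} r
        * ennreal (1 / sqrt (1 + r\<^sup>2)))) \<partial>lborel)"
      by (intro nn_integral_cong) (auto simp: indicator_def)
    also have "\<dots> = ennreal (?f t)"
      unfolding radial_integral using T1[OF True] by simp
    finally show ?thesis using True by simp
  next
    case False
    then have "t < 0 \<or> t > pi/2" using t by auto
    then have "sin t < 0 \<or> cos t < 0"
    proof
      assume "t < 0"
      then have "sin (- t) > 0" using t by (intro sin_gt_zero) auto
      then show ?thesis by simp
    next
      assume "t > pi/2"
      then have "sin (t - pi/2) > 0" using t by (intro sin_gt_zero) auto
      then show ?thesis by (simp add: sin_diff)
    qed
    then have "lift (r * cos t, r * sin t) \<notin> P2" if "r > 0" for r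
      using that by (auto simp: P2_def zero_le_mult_iff)
    then have "(\<integral>\<^sup>+r. indicator {0<..} r * (ennreal r * (indicator {r. lift (r * cos t, r * sin t) \<in> P2} r
        * ennreal (1 / sqrt (1 + r\<^sup>2)))) \<partial>lborel) = (\<integral>\<^sup>+(r::real). 0 \<partial>lborel)"
      by (intro nn_integral_cong) (auto simp: indicator_def)
    then show ?thesis using False t by (auto simp: indicator_def)
  qed
  have "hyp_area P2 = (\<integral>\<^sup>+t. indicator {-pi/2..3*pi/2} t *
     (\<integral>\<^sup>+r. indicator {0<..} r * (ennreal r * (indicator {r. lift (r * cos t, r * sin t) \<in> P2} r
        * ennreal (1 / sqrt (1 + r\<^sup>2)))) \<partial>lborel) \<partial>lborel)"
    unfolding P2_eq_region by (rule hyp_area_polar)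
  also have "\<dots> = (\<integral>\<^sup>+t. ennreal (?f t) * indicator {0<..<pi/2} t \<partial>lborel)"
  proof (rule nn_integral_cong_AE)
    show "AE t in lborel. indicator {-pi/2..3*pi/2} t *
     (\<integral>\<^sup>+r. indicator {0<..} r * (ennreal r * (indicator {r. lift (r * cos t, r * sin t) \<in> P2} r
        * ennreal (1 / sqrt (1 + r\<^sup>2)))) \<partial>lborel) = ennreal (?f t) * indicator {0<..<pi/2} t"
      using AE_lborel_singleton[of "0::real"] AE_lborel_singleton[of "pi/2"] AE_lborel_singleton[of "3*pi/2"]
    proof eventually_elim
      case (elim t)
      show ?case
      proof (cases "t \<in> {-pi/2..3*pi/2}")
        case True
        then show ?thesis unfolding inner[OF True elim] by (simp only: indicator_simps mult_1_left)
      next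
        case False
        then have "t \<notin> {0<..<pi/2}" by auto
        then show ?thesis using False by simp
      qed
    qed
  qed
  also have "\<dots> = ennreal (pi / 2)"
  proof (rule nn_integral_has_integral_lebesgue')
    show "0 \<le> ?f t" if "t \<in> {0<..<pi/2}" for t
    proof -
      have "(?T t)\<^sup>2 - 1 > 0" using T1[OF that] by (simp add: one_less_power)
      moreover have "sqrt ((?T t)\<^sup>2 - 1) \<le> sqrt ((?T t)\<^sup>2)" by (rule real_sqrt_le_mono) simp
      ultimately show ?thesis using T1[OF that] by simp
    qed
    \<comment> \<open>The derivative of the arcsine blows up at both ends, which are the ideal
      vertices, so the primitive is differentiated only in the interior.\<close>
    have "(?f has_integral ((arcsin (sin (pi/2) - cos (pi/2)) - pi/2) - (arcsin (sin 0 - cos 0) - 0))) {0..pi/2}"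
    proof (rule fundamental_theorem_of_calculus_interior)
      have "-1 \<le> sin t - cos t \<and> sin t - cos t \<le> 1" if "t \<in> {0..pi/2}" for t :: real
      proof -
        have "sin t \<ge> 0" "cos t \<ge> 0" using that by (auto intro!: sin_ge_zero cos_ge_zero)
        then show ?thesis using sin_le_one[of t] cos_le_one[of t] by linarith
      qed
      then show "continuous_on {0..pi/2} (\<lambda>t::real. arcsin (sin t - cos t) - t)"
        by (intro continuous_intros) auto
      fix t :: real assume t: "t \<in> {0<..<pi/2}"
      then have "sin t > 0" "cos t > 0" by (auto intro: sin_gt_zero cos_gt_zero)
      then have "(sin t - cos t)\<^sup>2 < 1" using T2(2)[of t] by (smt (verit) mult_pos_pos)
      then have "-1 < sin t - cos t" "sin t - cos t < 1"
        by (auto simp: abs_square_less_1 abs_less_iff)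
      then have "((\<lambda>t. arcsin (sin t - cos t) - t) has_real_derivative
          inverse (sqrt (1 - (sin t - cos t)\<^sup>2)) * (cos t + sin t) - 1) (at t)"
        by (auto intro!: derivative_eq_intros)
      then show "((\<lambda>t. arcsin (sin t - cos t) - t) has_vector_derivative ?f t) (at t)"
        unfolding T2 has_real_derivative_iff_has_vector_derivative[symmetric]
        by (simp add: field_simps)
    qed simp
    then show "(?f has_integral pi / 2) {0<..<pi/2}" by (simp add: has_integral_Icc_iff_Ioo)
  qed
  finally show ?thesis .
qed

lemma right_angled_polygon_P2: "right_angled_polygon P2"
  unfolding right_angled_polygon_def
  using hyp_polygon_P2 P2_angle by (auto simp: hyp_area_P2)

section \<open>Reduction of an arbitrary right-angled polygon to a pointed one\<close>

lemma mink_self_nonneg: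
  assumes p: "p \<in> H2" and w: "mink p w = 0"
  shows "mink w w \<ge> 0"
proof -
  have p3: "(p$3)\<^sup>2 = 1 + (p$1)\<^sup>2 + (p$2)\<^sup>2" "p$3 > 0" using p by (auto simp: H2_def)
  have "p$1 * w$1 + p$2 * w$2 = p$3 * w$3" using w by (simp add: mink_def)
  then have "(p$3)\<^sup>2 * (w$3)\<^sup>2 = (p$1 * w$1 + p$2 * w$2)\<^sup>2" by (simp add: power_mult_distrib)
  \<comment> \<open>Lagrange's identity; dropping the last square gives Cauchy-Schwarz.\<close>
  also have "\<dots> = ((p$1)\<^sup>2 + (p$2)\<^sup>2) * ((w$1)\<^sup>2 + (w$2)\<^sup>2) - (p$1 * w$2 - p$2 * w$1)\<^sup>2"
    by (simp add: power2_eq_square algebra_simps)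
  also have "\<dots> \<le> ((p$1)\<^sup>2 + (p$2)\<^sup>2) * ((w$1)\<^sup>2 + (w$2)\<^sup>2)" by simp
  also have "\<dots> \<le> (p$3)\<^sup>2 * ((w$1)\<^sup>2 + (w$2)\<^sup>2)"
    unfolding p3 by (intro mult_right_mono) auto
  finally have "(w$3)\<^sup>2 \<le> (w$1)\<^sup>2 + (w$2)\<^sup>2" using p3(2) by simp
  then show ?thesis by (simp add: mink_def power2_eq_square)
qed

text \<open>Inverting \<open>arccos\<close> requires an argument between -1 and 1. The vectors
  \<open>u + v\<close> and \<open>u - v\<close> are orthogonal to the timelike \<open>p\<close>, so
  their Minkowski squares are nonnegative, which is exactly this bound.\<close>

lemma right_angle_mink:
  assumes p: "p \<in> H2" "mink p u = 0" "mink p v = 0" and u: "mink u u = 1" and v: "mink v v = 1"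
    and angle: "interior_angle u v = pi / 2"
  shows "mink u v = 0"
proof -
  have "mink p (u + v) = 0" "mink p (u - v) = 0"
    using p by (auto simp: mink_def algebra_simps)
  from this[THEN mink_self_nonneg[OF p(1)]]
  have "mink (u + v) (u + v) \<ge> 0" "mink (u - v) (u - v) \<ge> 0" .
  moreover have "mink (u + v) (u + v) = 2 + 2 * mink u v" "mink (u - v) (u - v) = 2 - 2 * mink u v"
    using u v by (auto simp: mink_def algebra_simps)
  ultimately have "cos (arccos (- mink u v)) = - mink u v" by (intro cos_arccos) auto
  then show ?thesis using angle unfolding interior_angle_def by (simp only: cos_pi_half)
qed

lemma right_angled_polygon_area_ge:
  assumes "right_angled_polygon P"
  shows "hyp_area P2 \<le> hyp_area P"
proof -
  obtain N where N: "hyp_polygon N P"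
    and angle: "\<And>u v p. \<lbrakk>u \<in> N; v \<in> N; p \<in> P; u \<noteq> v; mink p u = 0; mink p v = 0\<rbrakk> \<Longrightarrow> interior_angle u v = pi / 2"
    and area: "hyp_area P < \<infinity>"
    using assms unfolding right_angled_polygon_def by blast
  have fin: "finite N" and unit: "\<And>u. u \<in> N \<Longrightarrow> mink u u = 1" and P: "P = region N"
    using N by (auto simp: hyp_polygon_def region_def)
  obtain x where x: "x \<in> H2" "\<And>u. u \<in> N \<Longrightarrow> mink x u < 0"
    using N by (auto simp: hyp_polygon_def)
  show ?thesis
  proof (cases "N = {}")
    case True
    \<comment> \<open>Without sides \<open>P\<close> is the whole plane, and monotonicity
      suffices.\<close>
    then have "P2 \<subseteq> P" by (auto simp: P region_def P2_def)
    then show ?thesis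
      unfolding hyp_area_def by (intro nn_integral_mono) (auto simp: indicator_def)
  next
    case False
    obtain A where A: "isometry_H2 A" "A x = lift (0, 0)"
      using isometry_H2_transitive[OF x(1)] .
    have mink_A: "mink (A y) (A z) = mink y z" for y z using A(1) by (simp add: isometry_H2_def)
    interpret pointed_polygon "A ` N"
    proof
      show "finite (A ` N)" "A ` N \<noteq> {}" using fin False by auto
      show "mink u u = 1" if "u \<in> A ` N" for u using that unit by (auto simp: mink_A)
      show "u $ 3 > 0" if "u \<in> A ` N" for u
      proof -
        have "mink (A x) u < 0" using that x(2) by (auto simp: mink_A)
        then show ?thesis by (simp add: A(2) mink_def height_def)
      qed
      show "hyp_area (region (A ` N)) < \<infinity>"
        using A(1) area by (simp add: isometry_H2_def P)
      fix u v p assume *: "u \<in> A ` N" "v \<in> A ` N" "u \<noteq> v" "p \<in> region (A ` N)" "mink p u = 0" "mink p v = 0"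
      obtain u' v' where uv: "u = A u'" "u' \<in> N" "v = A v'" "v' \<in> N" using * by auto
      \<comment> \<open>Vertices of the moved polygon are pulled back to vertices of
        \<open>P\<close>, where the angle hypothesis applies; orthogonality is then carried forward
        by \<open>mink_A\<close>.\<close>
      have "p \<in> A ` H2" using *(4) A(1) by (simp add: isometry_H2_def region_def)
      then obtain p' where p': "p = A p'" "p' \<in> H2" by auto
      have "p' \<in> P" using *(4) p' by (auto simp: P region_def mink_A)
      have perp: "mink p' u' = 0" "mink p' v' = 0" using * uv p' by (auto simp: mink_A)
      have "u' \<noteq> v'" using *(3) uv by auto
      from right_angle_mink[OF p'(2) perp unit[OF uv(2)] unit[OF uv(4)]
          angle[OF uv(2,4) \<open>p' \<in> P\<close> this perp]]
      have "mink u' v' = 0" .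
      then show "mink u v = 0" by (simp add: uv mink_A)
    qed
    have "hyp_area P2 \<le> hyp_area (region (A ` N))"
      unfolding hyp_area_P2 by (rule area_ge)
    also have "\<dots> = hyp_area P" using A(1) by (simp add: isometry_H2_def P)
    finally show ?thesis .
  qed
qed

theorem theorem3p2:
  shows "right_angled_polygon P2 \<and>
         (\<forall>P. right_angled_polygon P \<longrightarrow> hyp_area P2 \<le> hyp_area P)"
  using right_angled_polygon_P2 right_angled_polygon_area_ge by blast

end
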